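(* Let $G:(0,\infty)\times S^{n-1}\to(0,\infty)$ and $\psi:(0,\infty)\to(0,\infty)$ be continuous, and write $G_t(t,u)=\partial G(t,u)/\partial t$. Suppose that one of the following two conditions holds: (a) $G_t>0$ on $(0,\infty)\times S^{n-1}$, and if $$\frac{G_t(t,u)}{\psi(s)}\ge\frac{\lambda\,G_t(\lambda t,u)}{\psi(\lambda s)}$$ for some $\lambda,s,t>0$ and $u\in S^{n-1}$, then $\lambda\ge1$; (b) $G_t<0$ on $(0,\infty)\times S^{n-1}$, and if $$\frac{G_t(t,u)}{\psi(s)}\le\frac{\lambda\,G_t(\lambda t,u)}{\psi(\lambda s)}$$ for some $\lambda,s,t>0$ and $u\in S^{n-1}$, then $\lambda\ge1$. If $K,K'\in\mathcal{K}_{(o)}^n$ are both polytopes or both have support functions in $C^2$, and $\widetilde{C}_{G,\psi}(K,\cdot)=\widetilde{C}_{G,\psi}(K',\cdot)$, then $K=K'$.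
   Context: Let $o$ be the origin of $\mathbb{R}^n$ and $S^{n-1}$ the unit sphere; $du$ denotes integration with respect to $(n-1)$-dimensional Hausdorff measure $\mathcal{H}^{n-1}$. $\mathcal{K}_{(o)}^n$ is the class of compact convex subsets of $\mathbb{R}^n$ containing $o$ in their interiors. A polytope is the convex hull of a finite set. For $K\in\mathcal{K}_{(o)}^n$ and $u\in S^{n-1}$, $h_K(u)=\max\{\langle u,x\rangle:x\in K\}$ is the support function and $\rho_K(u)=\max\{\lambda\ge0:\lambda u\in K\}$ is the radial function. The support function is in $C^2$ if it is twice continuously differentiable. For $K\in\mathcal{K}_{(o)}^n$ and a Borel set $E\subset S^{n-1}$, let $\boldsymbol{\alpha}_K^*(E)$ be the set of $u\in S^{n-1}$ such that some $v\in E$ is an outer unit normal vector of $K$ at the boundary point $\rho_K(u)u$, i.e. $\langle v,\rho_K(u)u\rangle=h_K(v)$. For $\mathcal{H}^{n-1}$-almost all $u\in S^{n-1}$ there is exactly one outer unit normal vector of $K$ at $\rho_K(u)u$, denoted by $\alpha_K(u)$. When $u\mapsto G_t(\rho_K(u),u)$ is integrable on $S^{n-1}$, the general dual Orlicz curvature measure of $K$ is the finite signed Borel measure on $S^{n-1}$ defined by $$\widetilde{C}_{G,\psi}(K,E)=\frac1n\int_{\boldsymbol{\alpha}_K^*(E)}\frac{\rho_K(u)\,G_t(\rho_K(u),u)}{\psi(h_K(\alpha_K(u)))}\,du,\qquad E\subset S^{n-1}\text{ Borel}.$$ *)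

theory Defs
  imports "HOL-Analysis.Analysis"
begin

text \<open>
  Hausdorff measure, normalised so that the k-dimensional measure on k-dimensional Euclidean
  space is Lebesgue measure. Empty covering sets contribute 0 also for k = 0, so that the
  0-dimensional measure is counting measure; boundedness is required of covering sets
  because \<^const>\<open>diameter\<close> is 0 on unbounded sets.
\<close>

definition hausdorff_premeasure :: "nat \<Rightarrow> real \<Rightarrow> 'a::metric_space set \<Rightarrow> ennreal" where
  "hausdorff_premeasure k \<delta> A =
     Inf {(\<Sum>i. if C i = {} then 0
                 else ennreal (unit_ball_vol (real k) * (diameter (C i) / 2) ^ k)) |
          C :: nat \<Rightarrow> 'a set.
          A \<subseteq> (\<Union>i. C i) \<and> (\<forall>i. bounded (C i) \<and> diameter (C i) \<le> \<delta>)}"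

definition hausdorff_outer :: "nat \<Rightarrow> 'a::metric_space set \<Rightarrow> ennreal" where
  "hausdorff_outer k A = (SUP \<delta>\<in>{0<..}. hausdorff_premeasure k \<delta> A)"

text \<open>
  The measurable sets are all Caratheodory-measurable sets rather than only the Borel sets.
  The reverse radial Gauss image of a Borel set is measurable in this sense but need not
  be Borel.
\<close>

definition hausdorff_measure :: "nat \<Rightarrow> 'a::metric_space measure" where
  "hausdorff_measure k =
     measure_of UNIV (lambda_system UNIV (Pow UNIV) (hausdorff_outer k)) (hausdorff_outer k)"

definition sphere_measure :: "(real ^ 'n) measure" where
  "sphere_measure = hausdorff_measure (CARD('n) - 1)"

definition convex_body_o :: "(real ^ 'n) set \<Rightarrow> bool" where
  "convex_body_o K \<longleftrightarrow> compact K \<and> convex K \<and> 0 \<in> interior K"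

definition support_fun :: "(real ^ 'n) set \<Rightarrow> real ^ 'n \<Rightarrow> real" where
  "support_fun K u = Sup ((\<lambda>x. u \<bullet> x) ` K)"

definition radial_fun :: "(real ^ 'n) set \<Rightarrow> real ^ 'n \<Rightarrow> real" where
  "radial_fun K u = Sup {l. 0 \<le> l \<and> l *\<^sub>R u \<in> K}"

definition C2_on :: "'a::real_normed_vector set \<Rightarrow> ('a \<Rightarrow> real) \<Rightarrow> bool" where
  "C2_on S f \<longleftrightarrow>
     (\<exists>(f' :: 'a \<Rightarrow> 'a \<Rightarrow>\<^sub>L real) (f'' :: 'a \<Rightarrow> 'a \<Rightarrow>\<^sub>L 'a \<Rightarrow>\<^sub>L real).
        (\<forall>x\<in>S. (f has_derivative blinfun_apply (f' x)) (at x)) \<and>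
        (\<forall>x\<in>S. (f' has_derivative blinfun_apply (f'' x)) (at x)) \<and>
        continuous_on S f'')"

text \<open>
  The support function is positively homogeneous of degree 1, and is never differentiable at
  the origin when the origin is an interior point of the body; hence the origin is excluded.
\<close>

definition C2_support :: "(real ^ 'n) set \<Rightarrow> bool" where
  "C2_support K \<longleftrightarrow> C2_on (UNIV - {0}) (support_fun K)"

definition outer_unit_normal :: "(real ^ 'n) set \<Rightarrow> real ^ 'n \<Rightarrow> real ^ 'n \<Rightarrow> bool" where
  "outer_unit_normal K x v \<longleftrightarrow> v \<in> sphere 0 1 \<and> v \<bullet> x = support_fun K v"

definition reverse_radial_gauss_image ::
    "(real ^ 'n) set \<Rightarrow> (real ^ 'n) set \<Rightarrow> (real ^ 'n) set" where
  "reverse_radial_gauss_image K E =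
     {u \<in> sphere 0 1. \<exists>v\<in>E. outer_unit_normal K (radial_fun K u *\<^sub>R u) v}"

text \<open>Meaningful only where the normal is unique, which is the case for almost all directions.\<close>

definition radial_gauss_map :: "(real ^ 'n) set \<Rightarrow> real ^ 'n \<Rightarrow> real ^ 'n" where
  "radial_gauss_map K u = (THE v. outer_unit_normal K (radial_fun K u *\<^sub>R u) v)"

definition partial_t :: "(real \<Rightarrow> 'a \<Rightarrow> real) \<Rightarrow> real \<Rightarrow> 'a \<Rightarrow> real" where
  "partial_t G t u = deriv (\<lambda>s. G s u) t"

text \<open>
  The dual Orlicz curvature measure is defined only for bodies satisfying this condition;
  without it the Bochner integral below could take the default value 0.
\<close>

definition dual_curvature_defined ::
    "(real \<Rightarrow> real ^ 'n \<Rightarrow> real) \<Rightarrow> (real ^ 'n) set \<Rightarrow> bool" where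
  "dual_curvature_defined G K \<longleftrightarrow>
     set_integrable sphere_measure (sphere 0 1) (\<lambda>u. partial_t G (radial_fun K u) u)"

definition dual_curvature_measure ::
    "(real \<Rightarrow> real ^ 'n \<Rightarrow> real) \<Rightarrow> (real \<Rightarrow> real) \<Rightarrow> (real ^ 'n) set \<Rightarrow> (real ^ 'n) set \<Rightarrow> real" where
  "dual_curvature_measure G \<psi> K E =
     1 / real CARD('n) *
     (LINT u:reverse_radial_gauss_image K E|sphere_measure.
        radial_fun K u * partial_t G (radial_fun K u) u
          / \<psi> (support_fun K (radial_gauss_map K u)))"

end

theory Submission
  imports Defs
begin

text \<open>
  Let h and h' be the support functions of K and K', and let g be the absolute value of
  \<open>G\<^sub>t\<close>. Both conditions on G and \<open>\<psi>\<close> say that \<open>t * g t u / \<psi> s\<close> decreases strictly when t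
  and s are multiplied by a common factor greater than 1. Suppose that h' exceeds h somewhere, and
  let \<open>l > 1\<close> be the maximum of h'/h on the sphere: K' is contained in l K and touches its
  boundary. For c just below l, let E be the set of unit normals v with \<open>h' v > c * h v\<close>.

  By Aleksandrov's lemma (\<open>aleksandrov_radial\<close>, \<open>aleksandrov_normal\<close>) the directions in which K'
  has a normal in E are directions in which K has all its normals in E, and the latter
  contain a nonempty open set. The curvature measure of E is thus, for K', an
  integral over a smaller set than for K. It remains to see that the integrand is smaller too:
  at a point where K' touches the boundary of l K, both the radial and the support function are
  multiplied by exactly l, so the hypothesis makes the density of K' smaller than that of
  K. As the two measures of E agree, this is absurd (\<open>no_separating_weight\<close>).

  For a polytope the normals take finitely many values in almost all directions, so for c close
  to l only normals of maximal ratio occur in E. If h is differentiable, every normal has a unique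
  support point, the density of K is a continuous function \<open>\<Phi>\<close> of the normal, and by compactness
  the density of K' is below \<open>\<Phi>\<close> on all of E; then the measures are compared after division by
  \<open>\<Phi>\<close>. Continuity of \<open>\<Phi>\<close> rests on the joint continuity of \<open>G\<^sub>t\<close>. It follows from monotonicity
  in t: up to the sign, G is a concave function of a primitive of \<open>\<psi> t / t\<close>, and derivatives of
  convergent concave functions converge (\<open>partial_derivative_jointly_continuous\<close>).

  Three facts about the Hausdorff measure of the sphere are used. Borel sets are measurable, by
  Caratheodory's criterion. Nonempty open sets are not null, because a cover of small cost yields a
  cover of small volume of the cone over the set. Almost all directions have a single normal: two
  normals give two points of the polar body at which the direction is maximal; the vectors for which
  two maximisers differ in a given coordinate meet every line in that coordinate direction countably
  often, hence form a Lebesgue null set; and a Lebesgue null cone meets the sphere in a null set by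
  Eilenberg's averaging argument.
\<close>

section \<open>Hausdorff outer measure and Caratheodory's criterion\<close>

definition hausdorff_cost :: "nat \<Rightarrow> 'a::metric_space set \<Rightarrow> ennreal" where
  "hausdorff_cost k C =
     (if C = {} then 0 else ennreal (unit_ball_vol (real k) * (diameter C / 2) ^ k))"

definition delta_cover :: "real \<Rightarrow> 'a::metric_space set \<Rightarrow> (nat \<Rightarrow> 'a set) \<Rightarrow> bool" where
  "delta_cover \<delta> A C \<longleftrightarrow> A \<subseteq> (\<Union>i. C i) \<and> (\<forall>i. bounded (C i) \<and> diameter (C i) \<le> \<delta>)"

lemma hausdorff_cost_empty [simp]: "hausdorff_cost k {} = 0"
  by (simp add: hausdorff_cost_def)

lemma hausdorff_premeasure_alt:
  "hausdorff_premeasure k \<delta> A = Inf {(\<Sum>i. hausdorff_cost k (C i)) | C. delta_cover \<delta> A C}"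
  unfolding hausdorff_premeasure_def hausdorff_cost_def delta_cover_def by simp

lemma hausdorff_premeasure_le:
  assumes "delta_cover \<delta> A C"
  shows "hausdorff_premeasure k \<delta> A \<le> (\<Sum>i. hausdorff_cost k (C i))"
  unfolding hausdorff_premeasure_alt using assms by (intro Inf_lower) blast

lemma hausdorff_premeasure_approx:
  assumes "hausdorff_premeasure k \<delta> A < b"
  obtains C where "delta_cover \<delta> A C" "(\<Sum>i. hausdorff_cost k (C i)) < b"
  using assms unfolding hausdorff_premeasure_alt Inf_less_iff by blast

lemma hausdorff_premeasure_mono:
  "A \<subseteq> B \<Longrightarrow> hausdorff_premeasure k \<delta> A \<le> hausdorff_premeasure k \<delta> B"
  unfolding hausdorff_premeasure_alt
  by (rule Inf_superset_mono) (auto simp: delta_cover_def)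

lemma hausdorff_premeasure_antimono:
  "\<delta> \<le> \<epsilon> \<Longrightarrow> hausdorff_premeasure k \<epsilon> A \<le> hausdorff_premeasure k \<delta> A"
  unfolding hausdorff_premeasure_alt
  by (rule Inf_superset_mono) (auto simp: delta_cover_def intro: order_trans)

lemma hausdorff_premeasure_empty:
  assumes "\<delta> > 0" shows "hausdorff_premeasure k \<delta> {} = 0"
proof -
  have "delta_cover \<delta> {} (\<lambda>i. {})" using assms by (simp add: delta_cover_def)
  from hausdorff_premeasure_le[OF this, of k] show ?thesis by simp
qed

lemma hausdorff_premeasure_countable_subadditive:
  assumes "\<delta> > 0"
  shows "hausdorff_premeasure k \<delta> (\<Union>i. A i) \<le> (\<Sum>i. hausdorff_premeasure k \<delta> (A i))"
proof (rule ennreal_le_epsilon)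
  fix e :: real assume fin: "(\<Sum>i. hausdorff_premeasure k \<delta> (A i)) < top" and "0 < e"
  have "\<exists>C. delta_cover \<delta> (A n) C \<and>
      (\<Sum>i. hausdorff_cost k (C i)) \<le> hausdorff_premeasure k \<delta> (A n) + e * (1/2) ^ Suc n" for n
  proof -
    have "hausdorff_premeasure k \<delta> (A n) < top"
      using fin by (metis ennreal_suminf_lessD infinity_ennreal_def)
    then have "hausdorff_premeasure k \<delta> (A n)
        < hausdorff_premeasure k \<delta> (A n) + ennreal (e * (1/2) ^ Suc n)"
      using \<open>0 < e\<close> by (simp add: ennreal_zero_less_mult_iff)
    then show ?thesis by (metis hausdorff_premeasure_approx order_less_imp_le)
  qed
  then obtain C where C: "\<And>n. delta_cover \<delta> (A n) (C n)"
    and cost: "\<And>n. (\<Sum>i. hausdorff_cost k (C n i)) \<le> hausdorff_premeasure k \<delta> (A n) + e * (1/2) ^ Suc n"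
    by metis
  define D where "D = case_prod C \<circ> prod_decode"
  have "delta_cover \<delta> (\<Union>i. A i) D"
    unfolding delta_cover_def
  proof (intro conjI subsetI allI)
    fix x assume "x \<in> (\<Union>i. A i)"
    then obtain n m where "x \<in> C n m"
      using C unfolding delta_cover_def by blast
    then have "x \<in> D (prod_encode (n, m))" by (simp add: D_def)
    then show "x \<in> (\<Union>i. D i)" by blast
  qed (use C in \<open>auto simp: D_def delta_cover_def split: prod.split\<close>)
  then have "hausdorff_premeasure k \<delta> (\<Union>i. A i) \<le> (\<Sum>i. hausdorff_cost k (D i))"
    by (rule hausdorff_premeasure_le)
  also have "\<dots> = (\<Sum>i. (case_prod (\<lambda>n m. hausdorff_cost k (C n m))) (prod_decode i))"
    by (simp add: D_def case_prod_beta)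
  also have "\<dots> = (\<Sum>n. \<Sum>m. hausdorff_cost k (C n m))"
    by (rule suminf_ennreal_2dimen) simp
  also have "\<dots> \<le> (\<Sum>n. hausdorff_premeasure k \<delta> (A n) + ennreal (e * (1/2) ^ Suc n))"
    by (rule suminf_le[OF cost summableI summableI])
  also have "\<dots> = (\<Sum>n. hausdorff_premeasure k \<delta> (A n)) + (\<Sum>n. ennreal e * ennreal ((1/2) ^ Suc n))"
    using \<open>0 < e\<close> by (subst suminf_add[symmetric]) (auto simp del: ennreal_suminf_cmult simp add: ennreal_mult[symmetric])
  also have "\<dots> = (\<Sum>n. hausdorff_premeasure k \<delta> (A n)) + ennreal e"
    unfolding ennreal_suminf_cmult
    by (subst suminf_ennreal_eq[OF zero_le_power power_half_series]) auto
  finally show "hausdorff_premeasure k \<delta> (\<Union>i. A i) \<le> (\<Sum>n. hausdorff_premeasure k \<delta> (A n)) + ennreal e" .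
qed

lemma hausdorff_premeasure_le_outer:
  "\<delta> > 0 \<Longrightarrow> hausdorff_premeasure k \<delta> A \<le> hausdorff_outer k A"
  unfolding hausdorff_outer_def by (rule SUP_upper) simp

lemma hausdorff_outer_leI:
  "(\<And>\<delta>. \<delta> > 0 \<Longrightarrow> hausdorff_premeasure k \<delta> A \<le> b) \<Longrightarrow> hausdorff_outer k A \<le> b"
  unfolding hausdorff_outer_def by (rule SUP_least) simp

lemma hausdorff_outer_mono: "A \<subseteq> B \<Longrightarrow> hausdorff_outer k A \<le> hausdorff_outer k B"
  by (meson hausdorff_outer_leI hausdorff_premeasure_le_outer hausdorff_premeasure_mono order_trans)

lemma hausdorff_outer_empty [simp]: "hausdorff_outer k {} = 0"
  by (metis hausdorff_outer_leI hausdorff_premeasure_empty le_zero_eq order_refl)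

lemma hausdorff_outer_countable_subadditive:
  "hausdorff_outer k (\<Union>i. A i) \<le> (\<Sum>i. hausdorff_outer k (A i))"
proof (rule hausdorff_outer_leI)
  fix \<delta> :: real assume "\<delta> > 0"
  then have "hausdorff_premeasure k \<delta> (\<Union>i. A i) \<le> (\<Sum>i. hausdorff_premeasure k \<delta> (A i))"
    by (rule hausdorff_premeasure_countable_subadditive)
  also have "\<dots> \<le> (\<Sum>i. hausdorff_outer k (A i))"
    by (rule suminf_le[OF hausdorff_premeasure_le_outer[OF \<open>\<delta> > 0\<close>] summableI summableI])
  finally show "hausdorff_premeasure k \<delta> (\<Union>i. A i) \<le> (\<Sum>i. hausdorff_outer k (A i))" .
qed

lemma outer_measure_space_hausdorff_outer: "outer_measure_space (Pow UNIV) (hausdorff_outer k)"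
  unfolding outer_measure_space_def positive_def increasing_def countably_subadditive_def
  by (simp add: hausdorff_outer_mono hausdorff_outer_countable_subadditive)

lemma hausdorff_outer_Un_le: "hausdorff_outer k (A \<union> B) \<le> hausdorff_outer k A + hausdorff_outer k B"
  using hausdorff_outer_countable_subadditive[of k "binaryset A B"]
  by (simp add: UN_binaryset_eq suminf_binaryset_eq)

text \<open>
  A set of diameter below d meets only one of A and B. A fine cover of the union
  therefore splits into covers of A and B without being counted twice.
\<close>
lemma hausdorff_outer_separated:
  assumes "d > 0" and sep: "\<And>x y. x \<in> A \<Longrightarrow> y \<in> B \<Longrightarrow> d \<le> dist x y"
  shows "hausdorff_outer k A + hausdorff_outer k B \<le> hausdorff_outer k (A \<union> B)"
proof -
  have pre: "hausdorff_premeasure k \<delta> A + hausdorff_premeasure k \<delta> B \<le> hausdorff_premeasure k \<delta> (A \<union> B)"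
    if "0 < \<delta>" "\<delta> < d" for \<delta>
    unfolding hausdorff_premeasure_alt[of k \<delta> "A \<union> B"]
  proof (rule Inf_greatest, clarify)
    fix C assume C: "delta_cover \<delta> (A \<union> B) C"
    define CA where "CA i = (if C i \<inter> A = {} then {} else C i)" for i
    define CB where "CB i = (if C i \<inter> B = {} then {} else C i)" for i
    have "CA i = {} \<or> CB i = {}" for i
    proof (rule ccontr)
      assume "\<not> ?thesis"
      then obtain x y where "x \<in> C i" "x \<in> A" "y \<in> C i" "y \<in> B"
        by (auto simp: CA_def CB_def split: if_splits)
      then have "dist x y \<le> \<delta>" "d \<le> dist x y"
        using C sep diameter_bounded_bound[of "C i" x y]
        unfolding delta_cover_def by (auto intro: order_trans)
      then show False using that by simp
    qed
    then have le: "hausdorff_cost k (CA i) + hausdorff_cost k (CB i) \<le> hausdorff_cost k (C i)" for i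
      by (metis CA_def CB_def add.right_neutral add_0 hausdorff_cost_empty order_refl zero_le)
    have bd: "bounded (C i)" "diameter (C i) \<le> \<delta>" for i
      using C by (auto simp: delta_cover_def)
    have cov: "x \<in> A \<union> B \<Longrightarrow> \<exists>i. x \<in> C i" for x
      using C unfolding delta_cover_def by blast
    have "A \<subseteq> (\<Union>i. CA i)" "B \<subseteq> (\<Union>i. CB i)"
      using cov by (fastforce simp: CA_def CB_def)+
    moreover have "bounded (CA i) \<and> diameter (CA i) \<le> \<delta>" "bounded (CB i) \<and> diameter (CB i) \<le> \<delta>" for i
      using bd[of i] \<open>0 < \<delta>\<close> by (simp_all add: CA_def CB_def)
    ultimately have "delta_cover \<delta> A CA" "delta_cover \<delta> B CB"
      by (simp_all add: delta_cover_def)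
    then have "hausdorff_premeasure k \<delta> A + hausdorff_premeasure k \<delta> B
        \<le> (\<Sum>i. hausdorff_cost k (CA i)) + (\<Sum>i. hausdorff_cost k (CB i))"
      by (intro add_mono hausdorff_premeasure_le)
    also have "\<dots> = (\<Sum>i. hausdorff_cost k (CA i) + hausdorff_cost k (CB i))"
      by (rule suminf_add[OF summableI summableI])
    also have "\<dots> \<le> (\<Sum>i. hausdorff_cost k (C i))"
      by (rule suminf_le[OF le summableI summableI])
    finally show "hausdorff_premeasure k \<delta> A + hausdorff_premeasure k \<delta> B \<le> (\<Sum>i. hausdorff_cost k (C i))" .
  qed
  have "hausdorff_outer k A + hausdorff_outer k B
      = (SUP \<delta>\<in>{0<..}. hausdorff_premeasure k \<delta> A + hausdorff_outer k B)"
    unfolding hausdorff_outer_def[of k A] by (subst ennreal_SUP_add_left) auto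
  also have "\<dots> \<le> hausdorff_outer k (A \<union> B)"
  proof (rule SUP_least)
    fix \<delta> :: real assume "\<delta> \<in> {0<..}"
    have "hausdorff_premeasure k \<delta> A + hausdorff_outer k B
      = (SUP \<epsilon>\<in>{0<..}. hausdorff_premeasure k \<delta> A + hausdorff_premeasure k \<epsilon> B)"
      unfolding hausdorff_outer_def[of k B] by (subst ennreal_SUP_add_right) auto
    also have "\<dots> \<le> hausdorff_outer k (A \<union> B)"
    proof (rule SUP_least)
      fix \<epsilon> :: real assume "\<epsilon> \<in> {0<..}"
      define m where "m = min (min \<delta> \<epsilon>) (d/2)"
      have m: "0 < m" "m < d" "m \<le> \<delta>" "m \<le> \<epsilon>"
        using \<open>\<delta> \<in> _\<close> \<open>\<epsilon> \<in> _\<close> \<open>d > 0\<close> by (auto simp: m_def)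
      have "hausdorff_premeasure k \<delta> A + hausdorff_premeasure k \<epsilon> B
          \<le> hausdorff_premeasure k m A + hausdorff_premeasure k m B"
        using m by (intro add_mono hausdorff_premeasure_antimono)
      also have "\<dots> \<le> hausdorff_premeasure k m (A \<union> B)" using m by (intro pre)
      also have "\<dots> \<le> hausdorff_outer k (A \<union> B)" using m by (intro hausdorff_premeasure_le_outer)
      finally show "hausdorff_premeasure k \<delta> A + hausdorff_premeasure k \<epsilon> B \<le> hausdorff_outer k (A \<union> B)" .
    qed
    finally show "hausdorff_premeasure k \<delta> A + hausdorff_outer k B \<le> hausdorff_outer k (A \<union> B)" .
  qed
  finally show ?thesis .
qed

text \<open>
  Caratheodory's criterion. The part of T off the closed set F is exhausted by the sets
  at distance at least 1/(j+1) from F. Layers whose indices differ by 2 are separated,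
  so the layers of each parity have total measure at most that of T, and the tails of the
  series of layers vanish.
\<close>
lemma closed_in_lambda_system_hausdorff:
  assumes "closed F"
  shows "F \<in> lambda_system UNIV (Pow UNIV) (hausdorff_outer k)"
proof (cases "F = {}")
  case True
  then show ?thesis
    by (simp add: lambda_system_def)
next
  case False
  let ?\<mu> = "hausdorff_outer k"
  have "?\<mu> (F \<inter> T) + ?\<mu> ((UNIV - F) \<inter> T) \<le> ?\<mu> T" for T
  proof (cases "?\<mu> T = top")
    case fin: False
    define B where "B j = {x \<in> T. 1 / real (Suc j) \<le> infdist x F}" for j
    define R where "R j = B (Suc j) - B j" for j
    have B_mono: "B i \<subseteq> B j" if "i \<le> j" for i j
    proof
      fix x assume "x \<in> B i"
      moreover have "1 / real (Suc j) \<le> 1 / real (Suc i)"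
        using that by (intro divide_left_mono) auto
      ultimately show "x \<in> B j" by (auto simp: B_def)
    qed
    have B_exhaust: "(UNIV - F) \<inter> T \<subseteq> (\<Union>j. B j)"
    proof
      fix x assume x: "x \<in> (UNIV - F) \<inter> T"
      then have "infdist x F > 0"
        using assms \<open>F \<noteq> {}\<close> in_closed_iff_infdist_zero[of F x] infdist_nonneg[of x F] by force
      then obtain j where "1 / real (Suc j) < infdist x F"
        by (meson nat_approx_posE)
      with x have "x \<in> B j" by (auto simp: B_def)
      then show "x \<in> (\<Union>j. B j)" by blast
    qed
    have main: "?\<mu> (F \<inter> T) + ?\<mu> (B j) \<le> ?\<mu> T" for j
    proof -
      have "?\<mu> (F \<inter> T) + ?\<mu> (B j) \<le> ?\<mu> ((F \<inter> T) \<union> B j)"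
      proof (rule hausdorff_outer_separated)
        fix x y assume "x \<in> F \<inter> T" "y \<in> B j"
        then show "1 / real (Suc j) \<le> dist x y"
          using infdist_le[of x F y] by (auto simp: B_def dist_commute)
      qed simp
      also have "\<dots> \<le> ?\<mu> T" by (rule hausdorff_outer_mono) (auto simp: B_def)
      finally show ?thesis .
    qed
    have parity: "(\<Sum>i<m. ?\<mu> (R (2 * i + p + 1))) \<le> ?\<mu> (B (2 * m + p))" for m p
    proof (induction m)
      case (Suc m)
      let ?j = "2 * m + p"
      have "(\<Sum>i<Suc m. ?\<mu> (R (2 * i + p + 1))) \<le> ?\<mu> (B ?j) + ?\<mu> (R (?j + 1))"
        using Suc by (simp add: add_right_mono)
      also have "\<dots> \<le> ?\<mu> (B ?j \<union> R (?j + 1))"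
      proof (rule hausdorff_outer_separated)
        show "1 / real (Suc ?j) - 1 / real (Suc (Suc ?j)) > 0"
          using divide_strict_left_mono[of "real (Suc ?j)" "real (Suc (Suc ?j))" 1] by simp
        fix x y assume "x \<in> B ?j" "y \<in> R (?j + 1)"
        then have "1 / real (Suc ?j) \<le> infdist x F" "infdist y F < 1 / real (Suc (Suc ?j))"
          by (auto simp: B_def R_def)
        moreover have "infdist x F \<le> infdist y F + dist x y"
          by (rule infdist_triangle)
        ultimately show "1 / real (Suc ?j) - 1 / real (Suc (Suc ?j)) \<le> dist x y"
          by linarith
      qed
      also have "\<dots> \<le> ?\<mu> (B (2 * Suc m + p))"
        using B_mono[of ?j "2 * Suc m + p"] by (intro hausdorff_outer_mono) (auto simp: R_def)
      finally show ?case .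
    qed simp
    have B_le: "?\<mu> (B j) \<le> ?\<mu> T" for j
      by (rule hausdorff_outer_mono) (auto simp: B_def)
    define r where "r n = ?\<mu> (R (Suc n))" for n
    have "(\<Sum>n<2 * m. r n) \<le> ?\<mu> T + ?\<mu> T" for m
    proof -
      have "(\<Sum>n<2 * m. r n) = (\<Sum>i<m. r (2 * i)) + (\<Sum>i<m. r (2 * i + 1))"
        by (induction m) (simp_all add: ac_simps)
      also have "\<dots> \<le> ?\<mu> (B (2 * m + 0)) + ?\<mu> (B (2 * m + 1))"
        using parity[of 0 m] parity[of 1 m] unfolding r_def by (intro add_mono) simp_all
      also have "\<dots> \<le> ?\<mu> T + ?\<mu> T"
        by (intro add_mono B_le)
      finally show ?thesis .
    qed
    moreover have "(\<Sum>n<m. r n) \<le> (\<Sum>n<2 * m. r n)" for m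
      by (rule sum_mono2) auto
    ultimately have "(\<Sum>n<m. r n) \<le> ?\<mu> T + ?\<mu> T" for m
      by (rule order_trans[rotated])
    then have r_le: "suminf r \<le> ?\<mu> T + ?\<mu> T"
      by (intro suminf_le_const summableI)
    then have r_fin: "suminf r \<noteq> top"
      using fin by (metis ennreal_add_eq_top top_unique)
    let ?lhs = "?\<mu> (F \<inter> T) + ?\<mu> ((UNIV - F) \<inter> T)"
    \<comment> \<open>Adding the first k layers to both sides replaces the tail of the series by its finite sum,
       which can be cancelled once k tends to infinity.\<close>
    have "(\<Sum>i<k. r i) + ?lhs \<le> ?\<mu> T + suminf r" for k
    proof -
      have "B (Suc k + m) \<subseteq> B (Suc k) \<union> (\<Union>n. R (Suc (n + k)))" for m
      proof (induction m)
        case (Suc m)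
        have "B (Suc k + Suc m) \<subseteq> B (Suc k + m) \<union> R (Suc (m + k))"
          by (auto simp: R_def add_ac)
        with Suc show ?case by blast
      qed simp
      then have "(\<Union>j. B j) \<subseteq> B (Suc k) \<union> (\<Union>n. R (Suc (n + k)))"
        using B_mono[of _ "Suc k + _"] by (meson UN_least le_add2 order_trans)
      with B_exhaust have "?\<mu> ((UNIV - F) \<inter> T) \<le> ?\<mu> (B (Suc k) \<union> (\<Union>n. R (Suc (n + k))))"
        by (intro hausdorff_outer_mono) blast
      also have "\<dots> \<le> ?\<mu> (B (Suc k)) + ?\<mu> (\<Union>n. R (Suc (n + k)))"
        by (rule hausdorff_outer_Un_le)
      also have "\<dots> \<le> ?\<mu> (B (Suc k)) + (\<Sum>n. r (n + k))"
        unfolding r_def by (intro add_left_mono hausdorff_outer_countable_subadditive)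
      finally have "?lhs \<le> ?\<mu> (F \<inter> T) + (?\<mu> (B (Suc k)) + (\<Sum>n. r (n + k)))"
        by (rule add_left_mono)
      also have "\<dots> \<le> ?\<mu> T + (\<Sum>n. r (n + k))"
        using main[of "Suc k"] by (simp add: add.assoc[symmetric] add_right_mono)
      finally have "(\<Sum>i<k. r i) + ?lhs \<le> ?\<mu> T + ((\<Sum>n. r (n + k)) + (\<Sum>i<k. r i))"
        by (metis add.assoc add.commute add_left_mono)
      also have "(\<Sum>n. r (n + k)) + (\<Sum>i<k. r i) = suminf r"
        by (rule suminf_offset[symmetric, OF summableI])
      finally show ?thesis .
    qed
    then have "suminf r + ?lhs \<le> suminf r + ?\<mu> T"
      by (metis (no_types, lifting) add.commute ennreal_suminf_bound_add)
    then show ?thesis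
      using r_fin by (simp add: ennreal_add_left_cancel_le)
  qed simp
  moreover have "?\<mu> T \<le> ?\<mu> (F \<inter> T) + ?\<mu> ((UNIV - F) \<inter> T)" for T
    using hausdorff_outer_Un_le[of k "F \<inter> T" "(UNIV - F) \<inter> T"]
    by (simp add: Int_Un_distrib2[symmetric])
  ultimately show ?thesis
    unfolding lambda_system_def by (auto intro: antisym)
qed

lemma measure_space_lambda_hausdorff:
  "measure_space UNIV (lambda_system UNIV (Pow UNIV) (hausdorff_outer k)) (hausdorff_outer k)"
  by (rule sigma_algebra.caratheodory_lemma[OF sigma_algebra_Pow outer_measure_space_hausdorff_outer])

lemma space_hausdorff_measure [simp]: "space (hausdorff_measure k) = UNIV"
  by (simp add: hausdorff_measure_def space_measure_of_conv)

lemma sets_hausdorff_measure: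
  "sets (hausdorff_measure k) = lambda_system UNIV (Pow UNIV) (hausdorff_outer k)"
  unfolding hausdorff_measure_def
  by (rule sigma_algebra.sets_measure_of_eq)
     (use measure_space_lambda_hausdorff[of k] in \<open>unfold measure_space_def, blast\<close>)

lemma emeasure_hausdorff_measure:
  assumes "A \<in> sets (hausdorff_measure k)"
  shows "emeasure (hausdorff_measure k) A = hausdorff_outer k A"
  by (rule emeasure_measure_of[OF hausdorff_measure_def _ _ _ assms])
     (use measure_space_lambda_hausdorff[of k] in
       \<open>unfold measure_space_def sets_hausdorff_measure, blast+\<close>)

lemma sets_borel_hausdorff_measure:
  "sets borel \<subseteq> sets (hausdorff_measure k :: 'a::metric_space measure)"
proof -
  have "sigma_sets UNIV (Collect closed) \<subseteq> sets (hausdorff_measure k :: 'a measure)"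
    using sets.sigma_sets_subset[of "Collect closed" "hausdorff_measure k :: 'a measure"]
    unfolding sets_hausdorff_measure space_hausdorff_measure
    using closed_in_lambda_system_hausdorff by blast
  then show ?thesis by (simp add: borel_eq_closed)
qed

text \<open>
  A set of outer measure zero splits every set additively, by monotonicity and subadditivity.
\<close>
lemma hausdorff_null_set:
  assumes "hausdorff_outer k N = 0"
  shows "N \<in> null_sets (hausdorff_measure k)"
proof -
  have "hausdorff_outer k (N \<inter> T) + hausdorff_outer k ((UNIV - N) \<inter> T) = hausdorff_outer k T" for T
  proof (rule antisym)
    have "hausdorff_outer k (N \<inter> T) \<le> 0"
      using hausdorff_outer_mono[of "N \<inter> T" N k] assms by simp
    then show "hausdorff_outer k (N \<inter> T) + hausdorff_outer k ((UNIV - N) \<inter> T) \<le> hausdorff_outer k T"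
      by (simp add: hausdorff_outer_mono)
    show "hausdorff_outer k T \<le> hausdorff_outer k (N \<inter> T) + hausdorff_outer k ((UNIV - N) \<inter> T)"
      using hausdorff_outer_Un_le[of k "N \<inter> T" "(UNIV - N) \<inter> T"]
      by (simp add: Int_Un_distrib2[symmetric])
  qed
  then have "N \<in> sets (hausdorff_measure k)"
    by (simp add: sets_hausdorff_measure lambda_system_def)
  then show ?thesis
    using assms by (simp add: null_sets_def emeasure_hausdorff_measure)
qed

section \<open>Hausdorff measure on the sphere and Lebesgue measure\<close>

lemma hausdorff_cost_cball_le:
  fixes x :: "'a::euclidean_space"
  assumes "0 \<le> d"
  shows "hausdorff_cost k (cball x d) \<le> ennreal (unit_ball_vol (real k) * d ^ k)"
proof -
  have "diameter (cball x d) / 2 \<le> d"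
    using assms by simp
  then have "unit_ball_vol (real k) * (diameter (cball x d) / 2) ^ k \<le> unit_ball_vol (real k) * d ^ k"
    by (intro mult_left_mono power_mono) (use assms in auto)
  then show ?thesis
    using assms by (simp add: hausdorff_cost_def ennreal_leI)
qed

text \<open>
  A null set has an open neighbourhood of small volume, which is filled by cubes with disjoint
  interiors. For a cube, unlike a general box, the volume controls the power
  \<open>d ^ n\<close> of the radius of an enclosing ball. The sequence is padded with balls of radius 0,
  which contribute nothing to the sum because \<open>n > 0\<close>.
\<close>
lemma negligible_cover_cballs:
  fixes M :: "'a::euclidean_space set"
  assumes null: "M \<in> null_sets lborel" and "bounded M" and pos: "\<eta> > 0" "\<delta> > 0"
  obtains x :: "nat \<Rightarrow> 'a" and d :: "nat \<Rightarrow> real"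
    where "M \<subseteq> (\<Union>n. cball (x n) (d n))" "\<And>n. 0 \<le> d n" "\<And>n. d n \<le> \<delta>"
      "(\<Sum>n. ennreal (d n ^ DIM('a))) \<le> ennreal \<eta>"
proof -
  let ?n = "DIM('a)"
  obtain R where R: "R > 0" "M \<subseteq> cball 0 R"
    using \<open>bounded M\<close> by (metis bounded_pos mem_cball_0 subsetI)
  define b :: 'a where "b = R *\<^sub>R One"
  have "cball 0 R \<subseteq> cbox (-b) b"
  proof
    fix y :: 'a assume "y \<in> cball 0 R"
    then have "\<bar>y \<bullet> i\<bar> \<le> R" if "i \<in> Basis" for i
      using Basis_le_norm[OF that, of y] by simp
    then show "y \<in> cbox (-b) b"
      by (force simp: b_def mem_box abs_le_iff)
  qed
  with R have Mb: "M \<subseteq> cbox (-b) b" by blast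
  have b_comp: "b \<bullet> i = R" if "i \<in> Basis" for i using that by (simp add: b_def)
  have box_ne: "box (-b) b \<noteq> {}" using R by (simp add: box_ne_empty b_def)
  \<comment> \<open>A ball of radius n s contains a cube of side s, and (n s)^n is n^n times its volume.\<close>
  define \<eta>' where "\<eta>' = \<eta> / real ?n ^ ?n"
  have "\<eta>' > 0" using pos by (simp add: \<eta>'_def)
  have "M \<in> sets borel" using null by auto
  then obtain T where T: "open T" "M \<subseteq> T" "emeasure lborel (T - M) < ennreal \<eta>'"
    using outer_regular_lborel \<open>\<eta>' > 0\<close> by blast
  have "emeasure lborel T = emeasure lborel (T - M)"
    using null T(1) by (metis borel_open emeasure_Diff_null_set sets_lborel)
  with T(3) have T_small: "emeasure lborel T \<le> ennreal \<eta>'" by simp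
  define g where "g x = (if x \<in> T then T else UNIV) \<inter> ball x (\<delta> / 3)" for x
  have "gauge g"
    using \<open>open T\<close> \<open>\<delta> > 0\<close> by (auto simp: gauge_def g_def)
  obtain \<D> where D: "countable \<D>" "\<And>K. K \<in> \<D> \<Longrightarrow> interior K \<noteq> {} \<and> (\<exists>c d. K = cbox c d)"
    "pairwise (\<lambda>A B. interior A \<inter> interior B = {}) \<D>"
    "\<And>K. K \<in> \<D> \<Longrightarrow> \<exists>x \<in> M \<inter> K. K \<subseteq> g x"
    "\<And>u v. cbox u v \<in> \<D> \<Longrightarrow> \<exists>n. \<forall>i \<in> Basis. v \<bullet> i - u \<bullet> i = (b \<bullet> i - (-b) \<bullet> i) / 2^n"
    "M \<subseteq> \<Union>\<D>"
    using covering_lemma[OF Mb box_ne \<open>gauge g\<close>] by metis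
  have piece: "\<exists>x d. K \<subseteq> cball x d \<and> 0 \<le> d \<and> d \<le> \<delta> \<and> K \<subseteq> T \<and>
      ennreal (d ^ ?n) \<le> ennreal (real ?n ^ ?n) * emeasure lborel (interior K)" if KD: "K \<in> \<D>" for K
  proof -
    obtain u v where K: "K = cbox u v" using D(2)[OF KD] by blast
    obtain x where x: "x \<in> M" "x \<in> K" "K \<subseteq> g x" using D(4)[OF KD] by blast
    obtain m :: nat where m: "\<And>i. i \<in> Basis \<Longrightarrow> v \<bullet> i - u \<bullet> i = (b \<bullet> i - (-b) \<bullet> i) / 2^m"
      using D(5)[OF KD[unfolded K]] by blast
    define s where "s = 2 * R / 2 ^ m"
    have "s > 0" using R by (simp add: s_def)
    have side: "v \<bullet> i - u \<bullet> i = s" if "i \<in> Basis" for i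
      using m[OF that] that by (simp add: s_def b_comp)
    define d where "d = min \<delta> (real ?n * s)"
    have "dist x y \<le> d" if "y \<in> K" for y
    proof -
      have "dist x y \<le> \<delta>"
        using x(3) that \<open>\<delta> > 0\<close> by (force simp: g_def)
      moreover have "norm (x - y) \<le> (\<Sum>i\<in>Basis. \<bar>(x - y) \<bullet> i\<bar>)"
        by (rule norm_le_l1)
      moreover have "(\<Sum>i\<in>Basis. \<bar>(x - y) \<bullet> i\<bar>) \<le> (\<Sum>i\<in>(Basis::'a set). s)"
      proof (rule sum_mono)
        fix i :: 'a assume i: "i \<in> Basis"
        have "u \<bullet> i \<le> x \<bullet> i" "x \<bullet> i \<le> v \<bullet> i" "u \<bullet> i \<le> y \<bullet> i" "y \<bullet> i \<le> v \<bullet> i"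
          using x(2) that i by (auto simp: K mem_box)
        then show "\<bar>(x - y) \<bullet> i\<bar> \<le> s"
          using side[OF i] by (simp add: inner_diff_left)
      qed
      ultimately show ?thesis by (simp add: d_def dist_norm)
    qed
    then have "K \<subseteq> cball x d" by auto
    moreover have "K \<subseteq> T" using x T(2) by (auto simp: g_def subset_iff)
    moreover have "ennreal (d ^ ?n) \<le> ennreal (real ?n ^ ?n) * emeasure lborel (interior K)"
    proof -
      have le: "\<And>i. i \<in> Basis \<Longrightarrow> u \<bullet> i \<le> v \<bullet> i"
        using side \<open>s > 0\<close> by (smt (verit))
      have "emeasure lborel (interior K) = ennreal (\<Prod>i\<in>Basis. (v - u) \<bullet> i)"
        using le by (simp add: K interior_cbox)
      also have "(\<Prod>i\<in>Basis. (v - u) \<bullet> i) = (\<Prod>i\<in>(Basis :: 'a set). s)"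
        by (rule prod.cong) (use side in \<open>auto simp: inner_diff_left\<close>)
      also have "\<dots> = s ^ ?n" by simp
      finally have e: "emeasure lborel (interior K) = ennreal (s ^ ?n)" .
      have "d ^ ?n \<le> (real ?n * s) ^ ?n"
        using \<open>s > 0\<close> \<open>\<delta> > 0\<close> by (intro power_mono) (auto simp: d_def)
      then show ?thesis
        using \<open>s > 0\<close> by (simp add: e power_mult_distrib ennreal_mult[symmetric] ennreal_leI del: ennreal_power)
    qed
    moreover have "0 \<le> d" "d \<le> \<delta>" using \<open>s > 0\<close> \<open>\<delta> > 0\<close> by (auto simp: d_def)
    ultimately show ?thesis by blast
  qed
  then obtain X r where Xr: "\<And>K. K \<in> \<D> \<Longrightarrow> K \<subseteq> cball (X K) (r K) \<and> 0 \<le> r K \<and> r K \<le> \<delta> \<and> K \<subseteq> T \<and>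
      ennreal (r K ^ ?n) \<le> ennreal (real ?n ^ ?n) * emeasure lborel (interior K)"
    by metis
  define I where "I = to_nat_on \<D> ` \<D>"
  define x where "x n = (if n \<in> I then X (from_nat_into \<D> n) else 0)" for n
  define d where "d n = (if n \<in> I then r (from_nat_into \<D> n) else 0)" for n
  define E where "E n = (if n \<in> I then interior (from_nat_into \<D> n) else {})" for n
  have I: "\<exists>K\<in>\<D>. from_nat_into \<D> n = K \<and> n = to_nat_on \<D> K" if "n \<in> I" for n
    using that \<open>countable \<D>\<close> by (auto simp: I_def)
  show ?thesis
  proof
    show "M \<subseteq> (\<Union>n. cball (x n) (d n))"
    proof
      fix y assume "y \<in> M"
      then obtain K where "K \<in> \<D>" "y \<in> K" using D(6) by blast
      then have "y \<in> cball (x (to_nat_on \<D> K)) (d (to_nat_on \<D> K))"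
        using Xr[of K] \<open>countable \<D>\<close> by (auto simp: x_def d_def I_def)
      then show "y \<in> (\<Union>n. cball (x n) (d n))" by blast
    qed
    show "0 \<le> d n" "d n \<le> \<delta>" for n
      using I[of n] Xr \<open>\<delta> > 0\<close> by (auto simp: d_def)
    have dn: "ennreal (d n ^ ?n) \<le> ennreal (real ?n ^ ?n) * emeasure lborel (E n)" for n
      using I[of n] Xr by (auto simp: d_def E_def)
    have disj: "disjoint_family E"
      unfolding disjoint_family_on_def
    proof (intro ballI impI)
      fix m n :: nat assume "m \<noteq> n"
      show "E m \<inter> E n = {}"
      proof (cases "m \<in> I \<and> n \<in> I")
        case True
        then obtain K L where "K \<in> \<D>" "L \<in> \<D>" "from_nat_into \<D> m = K" "m = to_nat_on \<D> K"
          "from_nat_into \<D> n = L" "n = to_nat_on \<D> L" using I by metis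
        moreover from this have "K \<noteq> L" using \<open>m \<noteq> n\<close> by blast
        ultimately show ?thesis
          using D(3) True by (simp add: E_def pairwise_def)
      qed (auto simp: E_def)
    qed
    have "(\<Sum>n. ennreal (d n ^ ?n)) \<le> (\<Sum>n. ennreal (real ?n ^ ?n) * emeasure lborel (E n))"
      by (rule suminf_le[OF dn summableI summableI])
    also have "\<dots> = ennreal (real ?n ^ ?n) * emeasure lborel (\<Union>n. E n)"
      using disj by (subst ennreal_suminf_cmult, subst suminf_emeasure) (auto simp: E_def)
    also have "emeasure lborel (\<Union>n. E n) \<le> emeasure lborel T"
      using I Xr interior_subset T(1) by (intro emeasure_mono) (fastforce simp: E_def split: if_splits)+
    also note T_small
    also have "ennreal (real ?n ^ ?n) * ennreal \<eta>' = ennreal \<eta>"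
      using pos by (simp add: \<eta>'_def ennreal_mult[symmetric])
    finally show "(\<Sum>n. ennreal (d n ^ ?n)) \<le> ennreal \<eta>"
      by (simp add: mult_left_mono)
  qed
qed


text \<open>
  Eilenberg's averaging argument. A cover of the spherical shell over N by balls of small
  total volume restricts, for each radius t between 1 and 2, to a cover of the sphere of
  radius t. On average over t the ball of radius d contributes at most a constant times
  \<open>2 d * d\<^sup>k\<close>, so some radius has a cover of small total k-dimensional cost, and it can be
  scaled back to the unit sphere.
\<close>
lemma hausdorff_outer_zero_if_shell_null:
  fixes N :: "'a::euclidean_space set"
  assumes N: "N \<subseteq> sphere 0 1"
    and null: "{x. 1 \<le> norm x \<and> norm x \<le> 2 \<and> (1 / norm x) *\<^sub>R x \<in> N} \<in> null_sets lborel"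
      (is "?M \<in> _")
  shows "hausdorff_outer (DIM('a) - 1) N = 0"
proof -
  define k where "k = DIM('a) - 1"
  have Suc_k: "DIM('a) = Suc k" using DIM_positive[where 'a='a] by (simp add: k_def)
  define c where "c = unit_ball_vol (real k)"
  have "c > 0" by (simp add: c_def)
  have "hausdorff_premeasure k \<delta> N \<le> ennreal e" if "\<delta> > 0" "e > 0" for \<delta> e
  proof -
    have "bounded ?M" by (rule boundedI[of _ 2]) auto
    \<comment> \<open>The constants make the average cost over the radii at most e / 2, hence some cost at most e.\<close>
    have pos: "e / (4 * c) > 0" "\<delta> / 2 > 0" using \<open>c > 0\<close> that by simp_all
    obtain x d where cover: "?M \<subseteq> (\<Union>n. cball (x n) (d n))" and d: "\<And>n. 0 \<le> d n" "\<And>n. d n \<le> \<delta> / 2"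
      and small: "(\<Sum>n. ennreal (d n ^ DIM('a))) \<le> ennreal (e / (4 * c))"
      using negligible_cover_cballs[OF null \<open>bounded ?M\<close> pos] by blast
    define I where "I n = {norm (x n) - d n..norm (x n) + d n}" for n
    define \<phi> where "\<phi> t = (\<Sum>n. ennreal (c * d n ^ k) * indicator (I n) t)" for t
    have "(\<integral>\<^sup>+t. \<phi> t \<partial>lborel) = (\<Sum>n. ennreal (c * d n ^ k) * emeasure lborel (I n))"
      unfolding \<phi>_def by (subst nn_integral_suminf) (auto simp: I_def nn_integral_cmult)
    also have "\<dots> = (\<Sum>n. ennreal (2 * c) * ennreal (d n ^ DIM('a)))"
      using d(1) \<open>c > 0\<close> by (intro suminf_cong) (simp add: I_def Suc_k ennreal_mult[symmetric] mult_ac del: ennreal_power)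
    also have "\<dots> = ennreal (2 * c) * (\<Sum>n. ennreal (d n ^ DIM('a)))" by simp
    also have "\<dots> \<le> ennreal (2 * c) * ennreal (e / (4 * c))"
      by (intro mult_left_mono small) simp
    also have "\<dots> = ennreal (e / 2)"
      using \<open>c > 0\<close> that by (simp add: ennreal_mult[symmetric])
    finally have avg: "(\<integral>\<^sup>+t. \<phi> t \<partial>lborel) \<le> ennreal (e / 2)" .
    have "\<exists>t\<in>{1..2}. \<phi> t \<le> ennreal e"
    proof (rule ccontr)
      assume "\<not> ?thesis"
      then have "ennreal e * indicator {1..2} t \<le> \<phi> t" for t
        by (auto simp: indicator_def not_le intro: less_imp_le)
      then have "(\<integral>\<^sup>+t. ennreal e * indicator {1..2::real} t \<partial>lborel) \<le> (\<integral>\<^sup>+t. \<phi> t \<partial>lborel)"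
        by (intro nn_integral_mono)
      with avg have "ennreal e \<le> ennreal (e / 2)"
        by (simp add: nn_integral_cmult)
      then show False using that by simp
    qed
    then obtain t where t: "1 \<le> t" "t \<le> 2" "\<phi> t \<le> ennreal e" by auto
    define C where "C n = (if t \<in> I n then cball ((1 / t) *\<^sub>R x n) (d n) else {})" for n
    have "delta_cover \<delta> N C"
      unfolding delta_cover_def
    proof (intro conjI allI subsetI)
      fix u assume "u \<in> N"
      then have "norm u = 1" using N by auto
      then have "t *\<^sub>R u \<in> ?M" using t \<open>u \<in> N\<close> by simp
      then obtain n where n: "dist (x n) (t *\<^sub>R u) \<le> d n"
        using subsetD[OF cover] by (auto simp del: mem_Collect_eq)
      have "\<bar>norm (x n) - norm (t *\<^sub>R u)\<bar> \<le> d n"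
        using norm_triangle_ineq3[of "x n" "t *\<^sub>R u"] n by (simp add: dist_norm)
      then have "t \<in> I n" using \<open>norm u = 1\<close> t by (auto simp: I_def)
      have "(1 / t) *\<^sub>R x n - u = (1 / t) *\<^sub>R (x n - t *\<^sub>R u)"
        using t by (simp add: scaleR_diff_right)
      then have "dist ((1 / t) *\<^sub>R x n) u = dist (x n) (t *\<^sub>R u) / t"
        using t by (simp add: dist_norm)
      also have "\<dots> \<le> dist (x n) (t *\<^sub>R u)"
        using t by (simp add: divide_le_eq mult_le_cancel_left1)
      finally have "u \<in> C n" using n \<open>t \<in> I n\<close> by (simp add: C_def)
      then show "u \<in> (\<Union>n. C n)" by blast
    next
      fix n show "bounded (C n)" by (simp add: C_def)
      show "diameter (C n) \<le> \<delta>" using d[of n] that by (simp add: C_def)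
    qed
    then have "hausdorff_premeasure k \<delta> N \<le> (\<Sum>n. hausdorff_cost k (C n))"
      by (rule hausdorff_premeasure_le)
    also have "\<dots> \<le> \<phi> t"
      unfolding \<phi>_def
    proof (rule suminf_le[OF _ summableI summableI])
      fix n show "hausdorff_cost k (C n) \<le> ennreal (c * d n ^ k) * indicator (I n) t"
        using hausdorff_cost_cball_le[OF d(1)[of n], of k "(1 / t) *\<^sub>R x n"] by (simp add: C_def c_def)
    qed
    finally show ?thesis using t(3) by simp
  qed
  then have "hausdorff_outer k N \<le> ennreal e" if "e > 0" for e
    using that by (blast intro: hausdorff_outer_leI)
  then have "hausdorff_outer k N \<le> 0"
    using ennreal_le_epsilon[of 0 "hausdorff_outer k N"] by simp
  then show ?thesis by (simp add: k_def)
qed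

text \<open>
  A point t u of the cone over a cap of radius d about \<open>u\<^sub>0\<close> is within 2 d of \<open>j d u\<^sub>0\<close>, where
  j is the integer part of t/d. So about 1/d balls of radius 2 d cover the cone, and their total
  volume is of order \<open>d ^ (n - 1)\<close>.
\<close>
lemma cone_over_cap_cover:
  fixes u\<^sub>0 :: "'a::euclidean_space"
  assumes d: "0 < d" "d \<le> 1"
  defines "B \<equiv> \<Union>j\<le>nat \<lceil>1 / d\<rceil>. cball ((real j * d) *\<^sub>R u\<^sub>0) (2 * d)"
  shows "B \<in> sets borel"
    and "emeasure lborel B \<le> ennreal (3 * 2 ^ DIM('a) * unit_ball_vol (real DIM('a)) * d ^ (DIM('a) - 1))"
    and "\<And>u t. norm u = 1 \<Longrightarrow> dist u\<^sub>0 u \<le> d \<Longrightarrow> 0 \<le> t \<Longrightarrow> t \<le> 1 \<Longrightarrow> t *\<^sub>R u \<in> B"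
proof -
  let ?n = "DIM('a)" and ?m = "nat \<lceil>1 / d\<rceil>"
  define \<omega> where "\<omega> = unit_ball_vol (real ?n)"
  have "\<omega> > 0" by (simp add: \<omega>_def)
  show "B \<in> sets borel" unfolding B_def by (intro sets.finite_UN) auto
  have m: "real (Suc ?m) \<le> 3 / d"
  proof -
    have "0 < 1 / d" using d by simp
    then have "real ?m \<le> 1 / d + 1" by linarith
    then have "real (Suc ?m) \<le> 1 / d + 2" by simp
    also have "\<dots> \<le> 3 / d" using d by (simp add: field_simps)
    finally show ?thesis .
  qed
  have "emeasure lborel B \<le> (\<Sum>j\<le>?m. emeasure lborel (cball ((real j * d) *\<^sub>R u\<^sub>0) (2 * d)))"
    unfolding B_def by (rule emeasure_subadditive_finite) auto
  also have "\<dots> = ennreal (real (Suc ?m) * (\<omega> * (2 * d) ^ ?n))"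
    using d \<open>\<omega> > 0\<close> by (simp add: emeasure_cball \<omega>_def ennreal_of_nat_eq_real_of_nat ennreal_mult del: of_nat_Suc)
  also have "\<dots> \<le> ennreal (3 / d * (\<omega> * (2 * d) ^ ?n))"
    using d \<open>\<omega> > 0\<close> m by (intro ennreal_leI mult_right_mono) auto
  also have "3 / d * (\<omega> * (2 * d) ^ ?n) = 3 * 2 ^ ?n * \<omega> * d ^ (?n - 1)"
    using d power_minus_mult[of ?n d] by (simp add: power_mult_distrib field_simps)
  finally show "emeasure lborel B \<le> ennreal (3 * 2 ^ ?n * unit_ball_vol (real ?n) * d ^ (?n - 1))"
    by (simp add: \<omega>_def)
  fix u t assume u: "norm u = 1" "dist u\<^sub>0 u \<le> d" and t: "0 \<le> t" "t \<le> (1::real)"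
  define j where "j = nat \<lfloor>t / d\<rfloor>"
  have td: "0 \<le> t / d" "t / d \<le> 1 / d" using d t by (auto simp: divide_right_mono)
  then have "real j \<le> t / d" "t / d \<le> real j + 1" by (auto simp: j_def)
  then have j: "real j * d \<le> t" "t \<le> real j * d + d" using d by (auto simp: field_simps)
  have "j \<le> ?m" using td unfolding j_def by linarith
  have "dist ((real j * d) *\<^sub>R u\<^sub>0) (t *\<^sub>R u) = norm ((real j * d) *\<^sub>R (u\<^sub>0 - u) + (real j * d - t) *\<^sub>R u)"
    by (simp add: dist_norm algebra_simps)
  also have "\<dots> \<le> (real j * d) * norm (u\<^sub>0 - u) + \<bar>real j * d - t\<bar> * norm u"
    using d by (intro norm_triangle_le) simp
  also have "\<dots> \<le> 1 * d + d"
    using j u t d by (intro add_mono mult_mono) (auto simp: dist_norm)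
  finally have "t *\<^sub>R u \<in> cball ((real j * d) *\<^sub>R u\<^sub>0) (2 * d)" by simp
  then show "t *\<^sub>R u \<in> B" using \<open>j \<le> ?m\<close> unfolding B_def by blast
qed

text \<open>
  The cone over a piece of the sphere of diameter d has volume at most a constant times
  \<open>d\<^sup>k\<close>. Hence a cover of A of small k-dimensional cost bounds the volume of the cone
  over A, which has interior points when A contains a relatively open set.
\<close>
lemma hausdorff_outer_open_sphere_pos:
  fixes U :: "'a::euclidean_space set"
  assumes "open U" "U \<inter> sphere 0 1 \<noteq> {}"
  shows "hausdorff_outer (DIM('a) - 1) (U \<inter> sphere 0 1) \<noteq> 0"
proof
  define k where "k = DIM('a) - 1"
  let ?A = "U \<inter> sphere 0 1"
  define W where "W = {x. x \<noteq> 0 \<and> norm x < 1 \<and> (1 / norm x) *\<^sub>R x \<in> U}"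
  define c where "c = 3 * 2 ^ DIM('a) * unit_ball_vol (real DIM('a))"
  define \<omega> where "\<omega> = unit_ball_vol (real k)"
  have "\<omega> > 0" by (simp add: \<omega>_def)
  have "c > 0" by (simp add: c_def)
  assume "hausdorff_outer (DIM('a) - 1) ?A = 0"
  then have zero: "hausdorff_premeasure k (1/2) ?A = 0"
    using hausdorff_premeasure_le_outer[of "1/2" k ?A] by (simp add: k_def)
  have small: "emeasure lborel W \<le> ennreal (2 * c * \<eta>)" if "\<eta> > 0" for \<eta>
  proof -
    have "hausdorff_premeasure k (1/2) ?A < ennreal (\<omega> * \<eta> / 2 ^ k)"
      using zero \<open>\<eta> > 0\<close> \<open>\<omega> > 0\<close> by simp
    then obtain C where C: "delta_cover (1/2) ?A C" and cost: "(\<Sum>i. hausdorff_cost k (C i)) < ennreal (\<omega> * \<eta> / 2 ^ k)"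
      by (rule hausdorff_premeasure_approx)
    \<comment> \<open>The diameter may be 0, so it is replaced by a positive d whose k-th power is larger by a summable error.\<close>
    have "\<exists>d. 0 < d \<and> d \<le> 1 \<and> diameter (C i) \<le> d \<and> d ^ k \<le> diameter (C i) ^ k + \<eta> * (1/2) ^ Suc i" for i
    proof -
      let ?r = "diameter (C i)"
      have r: "0 \<le> ?r" "?r \<le> 1/2" using C by (auto simp: delta_cover_def diameter_ge_0)
      have "isCont (\<lambda>d. d ^ k) ?r" by simp
      then obtain s where "s > 0" and s: "\<And>d. dist d ?r < s \<Longrightarrow> dist (d ^ k) (?r ^ k) < \<eta> * (1/2) ^ Suc i"
        unfolding continuous_at_eps_delta using \<open>\<eta> > 0\<close>
        by (metis half_gt_zero_iff mult_pos_pos zero_less_one zero_less_power)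
      define d where "d = ?r + min (s/2) (1/2)"
      have "dist d ?r < s" using \<open>s > 0\<close> by (auto simp: d_def dist_real_def)
      then have "d ^ k \<le> ?r ^ k + \<eta> * (1/2) ^ Suc i" using s[of d] unfolding dist_real_def by linarith
      moreover have "0 < d" "d \<le> 1" "?r \<le> d" using r \<open>s > 0\<close> by (auto simp: d_def)
      ultimately show ?thesis by blast
    qed
    then obtain d where d: "\<And>i. 0 < d i" "\<And>i. d i \<le> 1" "\<And>i. diameter (C i) \<le> d i"
      "\<And>i. d i ^ k \<le> diameter (C i) ^ k + \<eta> * (1/2) ^ Suc i" by metis
    define p where "p i = (SOME u. u \<in> C i)" for i
    define B where "B i = (if C i = {} then {} else \<Union>j\<le>nat \<lceil>1 / d i\<rceil>. cball ((real j * d i) *\<^sub>R p i) (2 * d i))" for i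
    have B: "B i \<in> sets borel"
      "emeasure lborel (B i) \<le> ennreal (c * 2 ^ k / \<omega>) * hausdorff_cost k (C i) + ennreal (c * \<eta>) * ennreal ((1/2) ^ Suc i)" for i
    proof -
      show "B i \<in> sets borel" using cone_over_cap_cover(1)[OF d(1,2)] by (simp add: B_def)
      show "emeasure lborel (B i) \<le> ennreal (c * 2 ^ k / \<omega>) * hausdorff_cost k (C i) + ennreal (c * \<eta>) * ennreal ((1/2) ^ Suc i)"
      proof (cases "C i = {}")
        case False
        have D: "0 \<le> diameter (C i)" using C by (auto simp: delta_cover_def diameter_ge_0)
        have "emeasure lborel (B i) \<le> ennreal (c * d i ^ k)"
          using cone_over_cap_cover(2)[OF d(1,2)] False by (simp add: B_def c_def k_def)
        also have "\<dots> \<le> ennreal (c * (diameter (C i) ^ k + \<eta> * (1/2) ^ Suc i))"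
          using d(4)[of i] \<open>c > 0\<close> by (intro ennreal_leI mult_left_mono) auto
        also have "c * (diameter (C i) ^ k + \<eta> * (1/2) ^ Suc i)
            = c * 2 ^ k / \<omega> * (\<omega> * (diameter (C i) / 2) ^ k) + c * \<eta> * (1/2) ^ Suc i"
          using \<open>\<omega> > 0\<close> by (simp add: field_simps power_divide)
        also have "ennreal \<dots> = ennreal (c * 2 ^ k / \<omega>) * ennreal (\<omega> * (diameter (C i) / 2) ^ k)
            + ennreal (c * \<eta>) * ennreal ((1/2) ^ Suc i)"
          using \<open>\<omega> > 0\<close> \<open>c > 0\<close> \<open>\<eta> > 0\<close> D by (simp add: ennreal_mult[symmetric] ennreal_plus[symmetric] del: ennreal_plus power_Suc ennreal_power)
        finally show ?thesis using False by (simp add: hausdorff_cost_def \<omega>_def)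
      qed (simp add: B_def)
    qed
    have "W \<subseteq> (\<Union>i. B i)"
    proof
      fix x assume x: "x \<in> W"
      define u where "u = (1 / norm x) *\<^sub>R x"
      have u: "norm u = 1" "u \<in> U" "x = norm x *\<^sub>R u" using x by (auto simp: W_def u_def)
      then obtain i where i: "u \<in> C i" using C by (auto simp: delta_cover_def)
      then have "p i \<in> C i" unfolding p_def by (rule someI)
      have "dist (p i) u \<le> d i"
        using diameter_bounded_bound[OF _ \<open>p i \<in> C i\<close> i] C d(3)[of i] by (force simp: delta_cover_def)
      then have "norm x *\<^sub>R u \<in> B i"
        using cone_over_cap_cover(3)[OF d(1,2) u(1), of "p i" i "norm x"] x i by (auto simp: B_def W_def)
      then show "x \<in> (\<Union>i. B i)" using u(3) by auto
    qed
    then have "emeasure lborel W \<le> emeasure lborel (\<Union>i. B i)"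
      using B(1) by (intro emeasure_mono) auto
    also have "\<dots> \<le> (\<Sum>i. emeasure lborel (B i))"
      using B(1) by (intro emeasure_subadditive_countably) auto
    also have "\<dots> \<le> (\<Sum>i. ennreal (c * 2 ^ k / \<omega>) * hausdorff_cost k (C i) + ennreal (c * \<eta>) * ennreal ((1/2) ^ Suc i))"
      by (rule suminf_le[OF B(2) summableI summableI])
    also have "\<dots> = ennreal (c * 2 ^ k / \<omega>) * (\<Sum>i. hausdorff_cost k (C i)) + ennreal (c * \<eta>) * (\<Sum>i. ennreal ((1/2) ^ Suc i))"
      by (subst suminf_add[symmetric, OF summableI summableI]) (simp only: ennreal_suminf_cmult)
    also have "(\<Sum>i. ennreal ((1/2) ^ Suc i)) = ennreal 1"
      by (rule suminf_ennreal_eq[OF zero_le_power power_half_series]) auto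
    also have "ennreal (c * 2 ^ k / \<omega>) * (\<Sum>i. hausdorff_cost k (C i)) + ennreal (c * \<eta>) * ennreal 1
        \<le> ennreal (c * 2 ^ k / \<omega>) * ennreal (\<omega> * \<eta> / 2 ^ k) + ennreal (c * \<eta>) * ennreal 1"
      using cost by (intro add_right_mono mult_left_mono) auto
    also have "\<dots> = ennreal (2 * c * \<eta>)"
      using \<open>\<omega> > 0\<close> \<open>c > 0\<close> \<open>\<eta> > 0\<close> by (simp add: ennreal_mult[symmetric] ennreal_plus[symmetric] del: ennreal_plus)
    finally show ?thesis .
  qed
  have "emeasure lborel W \<le> 0"
  proof (rule ennreal_le_epsilon)
    fix e :: real assume "e > 0"
    then show "emeasure lborel W \<le> 0 + ennreal e"
      using small[of "e / (2 * c)"] \<open>c > 0\<close> by simp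
  qed
  moreover have "open W"
  proof -
    have "open ((- {0}) \<inter> (\<lambda>x. (1 / norm x) *\<^sub>R x) -` U)"
      by (rule continuous_open_preimage) (auto intro!: continuous_intros simp: \<open>open U\<close>)
    moreover have "W = ((- {0}) \<inter> (\<lambda>x. (1 / norm x) *\<^sub>R x) -` U) \<inter> ball 0 1"
      by (auto simp: W_def)
    ultimately show ?thesis by auto
  qed
  moreover have "W \<noteq> {}"
  proof -
    obtain u where "u \<in> U" "norm u = 1" using assms(2) by auto
    then have "(1/2) *\<^sub>R u \<in> W" by (auto simp: W_def)
    then show ?thesis by blast
  qed
  ultimately obtain x r where "r > 0" "ball x r \<subseteq> W" using open_contains_ball by blast
  then have "emeasure lborel (ball x r) \<le> emeasure lborel W"
    using \<open>open W\<close> by (intro emeasure_mono) auto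
  then have "emeasure lborel (ball x r) = 0"
    using \<open>emeasure lborel W \<le> 0\<close> by simp
  moreover have "unit_ball_vol (real DIM('a)) > 0" by simp
  ultimately show False using \<open>r > 0\<close> by (simp add: emeasure_ball)
qed

section \<open>Support and radial functions of convex bodies\<close>

lemma inner_le_support_fun:
  assumes "compact S" "x \<in> S"
  shows "v \<bullet> x \<le> support_fun S v"
proof -
  have "compact ((\<lambda>x. v \<bullet> x) ` S)"
    using \<open>compact S\<close> by (intro compact_continuous_image continuous_intros)
  then show ?thesis
    unfolding support_fun_def using \<open>x \<in> S\<close>
    by (intro cSup_upper) (auto dest: compact_imp_bounded bounded_imp_bdd_above)
qed

lemma support_fun_attained:
  assumes "compact S" "S \<noteq> {}"
  obtains x where "x \<in> S" "v \<bullet> x = support_fun S v"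
proof -
  have "continuous_on S (\<lambda>x. v \<bullet> x)" by (intro continuous_intros)
  then obtain x where x: "x \<in> S" "\<And>y. y \<in> S \<Longrightarrow> v \<bullet> y \<le> v \<bullet> x"
    using continuous_attains_sup[OF assms] by blast
  then have "support_fun S v = v \<bullet> x"
    unfolding support_fun_def by (intro cSup_eq_maximum) auto
  with x that show ?thesis by metis
qed

lemma continuous_on_support_fun:
  assumes "compact S" "S \<noteq> {}"
  shows "continuous_on A (support_fun S)"
proof -
  obtain R where R: "R \<ge> 0" "\<And>x. x \<in> S \<Longrightarrow> norm x \<le> R"
    using compact_imp_bounded[OF \<open>compact S\<close>] by (metis bounded_pos less_imp_le)
  have le: "support_fun S v - support_fun S w \<le> R * norm (v - w)" for v w
  proof -
    obtain x where x: "x \<in> S" "v \<bullet> x = support_fun S v"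
      using support_fun_attained[OF assms] by blast
    have "(v - w) \<bullet> x \<le> norm (v - w) * norm x" by (rule norm_cauchy_schwarz)
    also have "\<dots> \<le> R * norm (v - w)"
      using R x by (metis mult.commute mult_left_mono norm_ge_zero)
    finally show ?thesis
      using x inner_le_support_fun[OF assms(1) x(1), of w] by (simp add: inner_diff_left)
  qed
  have "R-lipschitz_on A (support_fun S)"
  proof (rule lipschitz_onI)
    fix v w
    show "dist (support_fun S v) (support_fun S w) \<le> R * dist v w"
      using le[of v w] le[of w v] by (auto simp: dist_norm norm_minus_commute abs_le_iff)
  qed (use R in auto)
  then show ?thesis by (rule lipschitz_on_continuous_on)
qed

lemma convex_body_o_D:
  assumes "convex_body_o K"
  shows "compact K" "convex K" "0 \<in> interior K" "0 \<in> K" "K \<noteq> {}" "closed K"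
  using assms interior_subset unfolding convex_body_o_def by (auto simp: compact_imp_closed)

lemma support_fun_lower_bound:
  assumes "convex_body_o K"
  obtains r where "r > 0" "\<And>v. r * norm v \<le> support_fun K v"
proof -
  obtain r where r: "r > 0" "cball 0 r \<subseteq> K"
    using convex_body_o_D(3)[OF assms] by (meson mem_interior_cball)
  have "r * norm v \<le> support_fun K v" for v
  proof (cases "v = 0")
    case True
    then show ?thesis
      using inner_le_support_fun[OF convex_body_o_D(1)[OF assms] convex_body_o_D(4)[OF assms], of v] by simp
  next
    case False
    have "(r / norm v) *\<^sub>R v \<in> K" using r False by auto
    from inner_le_support_fun[OF convex_body_o_D(1)[OF assms] this, of v]
    show ?thesis using False by (simp add: dot_square_norm power2_eq_square)
  qed
  with r that show ?thesis by blast
qed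

lemma support_fun_pos:
  assumes "convex_body_o K" "v \<noteq> 0"
  shows "support_fun K v > 0"
proof -
  obtain r where "r > 0" "r * norm v \<le> support_fun K v"
    using support_fun_lower_bound[OF assms(1)] by metis
  moreover have "0 < r * norm v" using \<open>r > 0\<close> assms(2) by simp
  ultimately show ?thesis by linarith
qed

lemma radial_fun_mem_upper:
  assumes K: "convex_body_o K" and u: "norm u = 1"
  shows "radial_fun K u > 0" "radial_fun K u *\<^sub>R u \<in> K"
    and "\<And>l. l \<ge> 0 \<Longrightarrow> l *\<^sub>R u \<in> K \<Longrightarrow> l \<le> radial_fun K u"
proof -
  let ?L = "{l. 0 \<le> l \<and> l *\<^sub>R u \<in> K}"
  obtain R where R: "\<And>x. x \<in> K \<Longrightarrow> norm x \<le> R"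
    using compact_imp_bounded[OF convex_body_o_D(1)[OF K]] by (metis bounded_iff)
  have "bounded ?L"
    using R u by (intro boundedI[of _ R]) fastforce
  moreover have "closed ?L"
  proof -
    have "?L = {0..} \<inter> (\<lambda>l. l *\<^sub>R u) -` K" by auto
    then show ?thesis
      by (simp add: convex_body_o_D(6)[OF K] continuous_closed_preimage continuous_intros)
  qed
  moreover have "0 \<in> ?L" using convex_body_o_D(4)[OF K] by simp
  ultimately have "bdd_above ?L \<and> Sup ?L \<in> ?L"
    by (metis (no_types, lifting) bounded_imp_bdd_above closed_contains_Sup empty_iff)
  then show "radial_fun K u *\<^sub>R u \<in> K" "\<And>l. l \<ge> 0 \<Longrightarrow> l *\<^sub>R u \<in> K \<Longrightarrow> l \<le> radial_fun K u"
    unfolding radial_fun_def by (auto intro: cSup_upper)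
  note up = this(2)
  obtain r where r: "r > 0" "cball 0 r \<subseteq> K"
    using convex_body_o_D(3)[OF K] by (meson mem_interior_cball)
  then have "r *\<^sub>R u \<in> K" using u by auto
  with up[of r] r show "radial_fun K u > 0" by auto
qed

text \<open>
  The functional is positive at x and so increases along the ray through x; K cannot contain points
  of the ray beyond x.
\<close>
lemma radial_fun_eq_if_normal:
  assumes K: "convex_body_o K" and x: "x \<in> K" and v: "v \<noteq> 0" and eq: "v \<bullet> x = support_fun K v"
  shows "x \<noteq> 0" "radial_fun K ((1 / norm x) *\<^sub>R x) = norm x"
proof -
  have pos: "v \<bullet> x > 0" using support_fun_pos[OF K v] eq by simp
  then show "x \<noteq> 0" by auto
  define u where "u = (1 / norm x) *\<^sub>R x"
  have u: "norm u = 1" "x = norm x *\<^sub>R u" using \<open>x \<noteq> 0\<close> by (auto simp: u_def)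
  note rad = radial_fun_mem_upper[OF K u(1)]
  have "norm x \<le> radial_fun K u" using rad(3)[of "norm x"] u(2) x by simp
  moreover have "radial_fun K u * (v \<bullet> u) \<le> norm x * (v \<bullet> u)"
    using inner_le_support_fun[OF convex_body_o_D(1)[OF K] rad(2), of v] eq u(2)
    by (metis inner_scaleR_right)
  moreover have "v \<bullet> u > 0" using pos \<open>x \<noteq> 0\<close> by (simp add: u_def)
  ultimately show "radial_fun K ((1 / norm x) *\<^sub>R x) = norm x"
    by (simp add: u_def[symmetric])
qed

lemma radial_point_not_interior:
  assumes K: "convex_body_o K" and u: "norm u = 1"
  shows "radial_fun K u *\<^sub>R u \<notin> interior K"
proof
  let ?x = "radial_fun K u *\<^sub>R u"
  assume "?x \<in> interior K"
  then obtain r where r: "r > 0" "cball ?x r \<subseteq> K" by (meson mem_interior_cball)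
  have "(radial_fun K u + r) *\<^sub>R u \<in> cball ?x r"
    using u r by (simp add: dist_norm algebra_simps)
  then have "radial_fun K u + r \<le> radial_fun K u"
    using r radial_fun_mem_upper[OF K u] by (metis add_nonneg_nonneg less_imp_le subsetD)
  then show False using r by simp
qed

lemma outer_unit_normalD:
  assumes K: "convex_body_o K" and u: "norm u = 1"
    and v: "outer_unit_normal K (radial_fun K u *\<^sub>R u) v"
  shows "norm v = 1" "v \<bullet> u > 0" "radial_fun K u * (v \<bullet> u) = support_fun K v"
proof -
  show "norm v = 1" using v by (simp add: outer_unit_normal_def)
  then have "v \<noteq> 0" by auto
  show eq: "radial_fun K u * (v \<bullet> u) = support_fun K v" using v by (simp add: outer_unit_normal_def)
  have "radial_fun K u * (v \<bullet> u) > 0"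
    unfolding eq by (rule support_fun_pos[OF K \<open>v \<noteq> 0\<close>])
  then show "v \<bullet> u > 0"
    using radial_fun_mem_upper(1)[OF K u] by (simp add: zero_less_mult_iff)
qed

lemma outer_unit_normalI:
  assumes K: "convex_body_o K" and u: "norm u = 1" and a: "a \<noteq> 0"
    and le: "\<And>y. y \<in> K \<Longrightarrow> a \<bullet> y \<le> a \<bullet> (radial_fun K u *\<^sub>R u)"
  shows "outer_unit_normal K (radial_fun K u *\<^sub>R u) ((1 / norm a) *\<^sub>R a)"
proof -
  let ?x = "radial_fun K u *\<^sub>R u" and ?v = "(1 / norm a) *\<^sub>R a"
  obtain y where y: "y \<in> K" "?v \<bullet> y = support_fun K ?v"
    using support_fun_attained[OF convex_body_o_D(1,5)[OF K]] by blast
  have "?v \<bullet> y \<le> ?v \<bullet> ?x"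
    using le[OF y(1)] by (simp add: divide_right_mono)
  moreover have "?v \<bullet> ?x \<le> support_fun K ?v"
    by (rule inner_le_support_fun[OF convex_body_o_D(1)[OF K] radial_fun_mem_upper(2)[OF K u]])
  ultimately show ?thesis using y a by (simp add: outer_unit_normal_def)
qed

lemma outer_unit_normal_exists:
  assumes K: "convex_body_o K" and u: "norm u = 1"
  shows "\<exists>v. outer_unit_normal K (radial_fun K u *\<^sub>R u) v"
proof -
  let ?x = "radial_fun K u *\<^sub>R u"
  have "?x \<in> K" "?x \<notin> rel_interior K"
    using radial_fun_mem_upper(2)[OF K u] radial_point_not_interior[OF K u] convex_body_o_D(3)[OF K]
      rel_interior_nonempty_interior[of K] by auto
  then obtain a where a: "a \<noteq> 0" "\<And>y. y \<in> K \<Longrightarrow> a \<bullet> ?x \<le> a \<bullet> y"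
    using supporting_hyperplane_rel_boundary[OF convex_body_o_D(2)[OF K]] by metis
  have "outer_unit_normal K ?x ((1 / norm (- a)) *\<^sub>R (- a))"
    by (rule outer_unit_normalI[OF K u]) (use a in auto)
  then show ?thesis by blast
qed

text \<open>
  The polar body turns boundary points into linear functionals: the normals of K at
  \<open>\<rho>\<^sub>K(u) u\<close>, rescaled to height one, are the points of the polar body at which
  the functional u is maximal.
\<close>
definition polar_body :: "(real ^ 'n) set \<Rightarrow> (real ^ 'n) set" where
  "polar_body K = {y. \<forall>z\<in>K. y \<bullet> z \<le> 1}"

lemma compact_polar_body:
  assumes K: "convex_body_o K"
  shows "compact (polar_body K)"
proof -
  obtain r where r: "r > 0" "\<And>v. r * norm v \<le> support_fun K v"
    using support_fun_lower_bound[OF K] by blast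
  have "norm y \<le> 1 / r" if "y \<in> polar_body K" for y
  proof -
    have "support_fun K y \<le> 1"
      using that support_fun_attained[OF convex_body_o_D(1,5)[OF K], of y] by (metis (no_types, lifting) mem_Collect_eq polar_body_def)
    then show ?thesis using r(1) r(2)[of y] by (simp add: field_simps)
  qed
  then have "bounded (polar_body K)" by (auto simp: bounded_iff)
  moreover have "closed (polar_body K)"
  proof -
    have "polar_body K = (\<Inter>z\<in>K. {y. z \<bullet> y \<le> 1})" by (auto simp: polar_body_def inner_commute)
    then show ?thesis by (auto intro: closed_halfspace_le)
  qed
  ultimately show ?thesis by (simp add: compact_eq_bounded_closed)
qed

lemma scaled_normal_in_polar_body:
  assumes K: "convex_body_o K" and u: "norm u = 1"
    and v: "outer_unit_normal K (radial_fun K u *\<^sub>R u) v"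
  defines "y \<equiv> (1 / support_fun K v) *\<^sub>R v"
  shows "y \<in> polar_body K" "u \<bullet> y = 1 / radial_fun K u" "u \<bullet> y = support_fun (polar_body K) u"
proof -
  note N = outer_unit_normalD[OF K u v] and rad = radial_fun_mem_upper[OF K u]
  have h: "support_fun K v > 0" using N(1) by (intro support_fun_pos[OF K]) auto
  show yQ: "y \<in> polar_body K"
    using inner_le_support_fun[OF convex_body_o_D(1)[OF K], of _ v] h
    by (auto simp: y_def polar_body_def divide_le_eq)
  show eq: "u \<bullet> y = 1 / radial_fun K u"
    using N h rad(1) by (simp add: y_def inner_commute field_simps)
  have "z \<bullet> u \<le> 1 / radial_fun K u" if "z \<in> polar_body K" for z
  proof -
    have "z \<bullet> (radial_fun K u *\<^sub>R u) \<le> 1"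
      using that rad(2) unfolding polar_body_def by blast
    then show ?thesis using rad(1) by (simp add: field_simps)
  qed
  moreover obtain z where "z \<in> polar_body K" "u \<bullet> z = support_fun (polar_body K) u"
    using support_fun_attained[OF compact_polar_body[OF K]] yQ by blast
  ultimately have "support_fun (polar_body K) u \<le> u \<bullet> y"
    using eq by (metis inner_commute)
  then show "u \<bullet> y = support_fun (polar_body K) u"
    using inner_le_support_fun[OF compact_polar_body[OF K] yQ, of u] by simp
qed

text \<open>
  On the sphere the radial function is the reciprocal of the support function of the polar body.
\<close>
lemma continuous_on_radial_fun:
  assumes K: "convex_body_o K"
  shows "continuous_on (sphere 0 1) (radial_fun K)"
proof -
  have eq: "radial_fun K u = 1 / support_fun (polar_body K) u"
    and pos: "support_fun (polar_body K) u \<noteq> 0" if "u \<in> sphere 0 1" for u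
  proof -
    have u: "norm u = 1" using that by simp
    obtain v where v: "outer_unit_normal K (radial_fun K u *\<^sub>R u) v"
      using outer_unit_normal_exists[OF K u] by blast
    have "1 / radial_fun K u = support_fun (polar_body K) u"
      using scaled_normal_in_polar_body(2,3)[OF K u v] by simp
    then show "radial_fun K u = 1 / support_fun (polar_body K) u" "support_fun (polar_body K) u \<noteq> 0"
      using radial_fun_mem_upper(1)[OF K u] by (metis divide_divide_eq_right div_by_1 mult_1, force)
  qed
  have "0 \<in> polar_body K" by (simp add: polar_body_def)
  then have "continuous_on (sphere 0 1) (\<lambda>u. 1 / support_fun (polar_body K) u)"
    using pos by (intro continuous_intros continuous_on_support_fun compact_polar_body[OF K]) auto
  then show ?thesis by (rule continuous_on_eq) (simp add: eq)
qed

text \<open>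
  Aleksandrov's lemma, in two halves. The boundary point of K' in direction u lies on the supporting
  hyperplane with normal v, and this does not meet c K if K' reaches further than c K in direction v.
  Conversely, if the boundary point of K' in direction u lies outside c K, the ray has crossed every
  supporting hyperplane of c K at the boundary point of c K in that direction.
\<close>
lemma aleksandrov_radial:
  assumes K: "convex_body_o K" and K': "convex_body_o K'" and u: "norm u = 1" and "c > 0"
    and v: "outer_unit_normal K' (radial_fun K' u *\<^sub>R u) v"
    and less: "c * support_fun K v < support_fun K' v"
  shows "c * radial_fun K u < radial_fun K' u"
proof -
  note N = outer_unit_normalD[OF K' u v]
  have "radial_fun K u * (v \<bullet> u) \<le> support_fun K v"
    using inner_le_support_fun[OF convex_body_o_D(1)[OF K] radial_fun_mem_upper(2)[OF K u], of v] by simp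
  then have "c * (radial_fun K u * (v \<bullet> u)) < radial_fun K' u * (v \<bullet> u)"
    using less N(3) \<open>c > 0\<close> by (smt (verit) mult_left_mono)
  then show ?thesis using N(2) by (simp add: mult.assoc[symmetric])
qed

lemma aleksandrov_normal:
  assumes K: "convex_body_o K" and K': "convex_body_o K'" and u: "norm u = 1"
    and w: "outer_unit_normal K (radial_fun K u *\<^sub>R u) w"
    and less: "c * radial_fun K u < radial_fun K' u"
  shows "c * support_fun K w < support_fun K' w"
proof -
  note N = outer_unit_normalD[OF K u w]
  have "c * support_fun K w = (c * radial_fun K u) * (w \<bullet> u)" using N(3) by simp
  also have "\<dots> < radial_fun K' u * (w \<bullet> u)" using less N(2) by (rule mult_strict_right_mono)
  also have "\<dots> \<le> support_fun K' w"
    using inner_le_support_fun[OF convex_body_o_D(1)[OF K'] radial_fun_mem_upper(2)[OF K' u], of w] by simp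
  finally show ?thesis .
qed

text \<open>
  For a support point z at v, the function \<open>h w - w \<bullet> z\<close> is nonnegative and vanishes at
  \<open>w = v\<close>. So the derivative of h at v is the inner product with z, and z is determined by v.
\<close>
lemma C2_support_unique_maximiser:
  assumes K: "convex_body_o K" and C2: "C2_support K" and v: "v \<noteq> 0"
    and x: "x \<in> K" "v \<bullet> x = support_fun K v" and y: "y \<in> K" "v \<bullet> y = support_fun K v"
  shows "x = y"
proof -
  obtain f' where f': "(support_fun K has_derivative blinfun_apply (f' v)) (at v)"
    using C2 v unfolding C2_support_def C2_on_def by blast
  have deriv: "blinfun_apply (f' v) w = w \<bullet> z" if z: "z \<in> K" "v \<bullet> z = support_fun K v" for z w
  proof -
    have "((\<lambda>w. support_fun K w - w \<bullet> z) has_derivative (\<lambda>w. f' v w - w \<bullet> z)) (at v)"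
      by (intro derivative_intros f')
    moreover have "(\<forall>w\<in>UNIV. support_fun K w - w \<bullet> z \<le> support_fun K v - v \<bullet> z) \<or>
          (\<forall>w\<in>UNIV. support_fun K v - v \<bullet> z \<le> support_fun K w - w \<bullet> z)"
        using inner_le_support_fun[OF convex_body_o_D(1)[OF K] z(1)] z(2) by auto
    ultimately have "(\<lambda>w. f' v w - w \<bullet> z) = (\<lambda>w. 0)"
      by (intro differential_zero_maxmin[of v UNIV]) auto
    then show ?thesis by (metis eq_iff_diff_eq_0)
  qed
  have "w \<bullet> x = w \<bullet> y" for w using deriv[OF x, of w] deriv[OF y, of w] by simp
  then show ?thesis by (metis inner_commute vector_eq_ldot)
qed

text \<open>
  A boundary point of a polytope lies on the bounding hyperplane of one of the finitely many
  half-spaces that define it; the normals of these hyperplanes suffice.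
\<close>
lemma polytope_finite_normals:
  fixes K :: "(real ^ 'n) set"
  assumes K: "convex_body_o K" and "polytope K"
  obtains W where "finite W"
    "\<And>u. norm u = 1 \<Longrightarrow> \<exists>v\<in>W. outer_unit_normal K (radial_fun K u *\<^sub>R u) v"
proof -
  obtain F where F: "finite F" "K = \<Inter>F" "\<And>h. h \<in> F \<Longrightarrow> \<exists>a b. a \<noteq> 0 \<and> h = {x. a \<bullet> x \<le> b}"
    using polytope_imp_polyhedron[OF \<open>polytope K\<close>] unfolding polyhedron_def by metis
  then obtain a b where ab: "\<And>h. h \<in> F \<Longrightarrow> a h \<noteq> 0 \<and> h = {x. a h \<bullet> x \<le> b h}" by metis
  show ?thesis
  proof
    show "finite ((\<lambda>h. (1 / norm (a h)) *\<^sub>R a h) ` F)" using F(1) by simp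
    fix u :: "real ^ 'n" assume u: "norm u = 1"
    let ?x = "radial_fun K u *\<^sub>R u"
    have "\<Inter> (interior ` F) \<subseteq> interior K"
      using F(1,2) interior_subset by (intro interior_maximal open_INT) blast+
    then obtain h where h: "h \<in> F" "?x \<notin> interior h"
      using radial_point_not_interior[OF K u] by auto
    have h_eq: "h = {x. a h \<bullet> x \<le> b h}" and a: "a h \<noteq> 0" using ab h by auto
    then have "interior h = {x. a h \<bullet> x < b h}" using interior_halfspace_le by metis
    then have ge: "a h \<bullet> ?x \<ge> b h" using h by auto
    have "outer_unit_normal K ?x ((1 / norm (a h)) *\<^sub>R a h)"
    proof (rule outer_unit_normalI[OF K u a])
      fix y assume "y \<in> K"
      then have "y \<in> h" using F(2) h(1) by blast
      then have "a h \<bullet> y \<le> b h" using h_eq by blast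
      with ge show "a h \<bullet> y \<le> a h \<bullet> ?x" by linarith
    qed
    then show "\<exists>v\<in>(\<lambda>h. (1 / norm (a h)) *\<^sub>R a h) ` F. outer_unit_normal K ?x v" using h(1) by blast
  qed
qed

lemma convex_body_subset_if_support_le:
  assumes K: "convex_body_o K" and K': "convex_body_o K'"
    and le: "\<And>v. norm v = 1 \<Longrightarrow> support_fun K' v \<le> support_fun K v"
  shows "K' \<subseteq> K"
proof
  fix x assume x: "x \<in> K'"
  show "x \<in> K"
  proof (rule ccontr)
    assume "x \<notin> K"
    then obtain a b where ab: "a \<bullet> x < b" "\<And>y. y \<in> K \<Longrightarrow> a \<bullet> y > b"
      using separating_hyperplane_closed_point[OF convex_body_o_D(2,6)[OF K]] by blast
    have "a \<noteq> 0" using ab convex_body_o_D(4)[OF K] by force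
    define v where "v = (1 / norm a) *\<^sub>R (- a)"
    have v: "norm v = 1" using \<open>a \<noteq> 0\<close> by (simp add: v_def)
    obtain y where y: "y \<in> K" "v \<bullet> y = support_fun K v"
      using support_fun_attained[OF convex_body_o_D(1,5)[OF K]] by blast
    have "a \<bullet> x < a \<bullet> y" using ab y by force
    then have "v \<bullet> y < v \<bullet> x" using \<open>a \<noteq> 0\<close> by (simp add: v_def divide_strict_right_mono)
    also have "\<dots> \<le> support_fun K' v" by (rule inner_le_support_fun[OF convex_body_o_D(1)[OF K'] x])
    finally show False using le[OF v] y by simp
  qed
qed

section \<open>Joint continuity of a monotone partial derivative\<close>

text \<open>
  If \<open>p(t,u) = (\<partial>G/\<partial>t) / q(t)\<close> is decreasing in t, then G is a concave function of a primitive
  of q, and derivatives of convergent concave functions converge. Concretely, a difference quotient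
  of G over an interval beside \<open>t\<^sub>0\<close>, but not touching it, is a value of \<open>\<partial>G/\<partial>t\<close> in that
  interval and depends continuously on u. Monotonicity of p makes this a one-sided bound
  for p near \<open>(t\<^sub>0, u\<^sub>0)\<close>.
\<close>
lemma derivative_value_beside:
  fixes G g :: "real \<Rightarrow> 'a::metric_space \<Rightarrow> real" and q :: "real \<Rightarrow> real"
  assumes cont: "continuous_on ({0<..} \<times> S) (\<lambda>(t, u). G t u)"
    and deriv: "\<And>t u. t > 0 \<Longrightarrow> u \<in> S \<Longrightarrow> ((\<lambda>s. G s u) has_real_derivative g t u) (at t)"
    and q: "continuous_on {0<..} q" "\<And>t. t > 0 \<Longrightarrow> q t > 0"
    and t\<^sub>0: "t\<^sub>0 > 0" and u\<^sub>0: "u\<^sub>0 \<in> S" and \<sigma>: "\<sigma> = 1 \<or> \<sigma> = (-1::real)" and "\<epsilon> > 0"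
  obtains h \<delta> where "0 < h" "2 * h < t\<^sub>0" "0 < \<delta>"
    "\<And>u. u \<in> S \<Longrightarrow> dist u u\<^sub>0 < \<delta> \<Longrightarrow>
       \<exists>z. h < z \<and> z < 2 * h \<and> \<bar>g (t\<^sub>0 + \<sigma> * z) u / q (t\<^sub>0 + \<sigma> * z) - g t\<^sub>0 u\<^sub>0 / q t\<^sub>0\<bar> < \<epsilon>"
proof -
  have \<sigma>2: "\<sigma> * \<sigma> = 1" "\<bar>\<sigma>\<bar> = 1" "\<sigma> \<noteq> 0" using \<sigma> by auto
  let ?g0 = "g t\<^sub>0 u\<^sub>0" and ?q0 = "q t\<^sub>0"
  have "((\<lambda>z. fst z / snd z) \<longlongrightarrow> ?g0 / ?q0) (at (?g0, ?q0))"
    using q(2)[OF t\<^sub>0] by (auto intro!: tendsto_eq_intros)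
  then have "isCont (\<lambda>z. fst z / snd z) (?g0, ?q0)" by (simp add: isCont_def)
  then obtain \<eta>' where "\<eta>' > 0" and \<eta>': "\<And>d r. dist (d, r) (?g0, ?q0) < \<eta>' \<Longrightarrow> \<bar>d / r - ?g0 / ?q0\<bar> < \<epsilon>"
    using \<open>\<epsilon> > 0\<close> unfolding continuous_at_eps_delta by (fastforce simp: dist_real_def)
  define \<eta> where "\<eta> = \<eta>' / 2"
  have "\<eta> > 0" using \<open>\<eta>' > 0\<close> by (simp add: \<eta>_def)
  have \<eta>: "\<bar>d / r - ?g0 / ?q0\<bar> < \<epsilon>" if "\<bar>d - ?g0\<bar> < \<eta>" "\<bar>r - ?q0\<bar> < \<eta>" for d r
  proof (rule \<eta>')
    have "dist (d, r) (?g0, ?q0) \<le> \<bar>d - ?g0\<bar> + \<bar>r - ?q0\<bar>"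
      unfolding dist_Pair_Pair dist_real_def using sqrt_sum_squares_le_sum_abs[of "\<bar>d - ?g0\<bar>"] by simp
    then show "dist (d, r) (?g0, ?q0) < \<eta>'" using that by (simp add: \<eta>_def)
  qed
  have "isCont q t\<^sub>0"
    using q(1) t\<^sub>0 by (simp add: continuous_on_eq_continuous_at)
  then obtain s\<^sub>1 where "s\<^sub>1 > 0" and s\<^sub>1: "\<And>t. \<bar>t - t\<^sub>0\<bar> < s\<^sub>1 \<Longrightarrow> \<bar>q t - ?q0\<bar> < \<eta>"
    using \<open>\<eta> > 0\<close> unfolding continuous_at_eps_delta dist_real_def by metis
  define Q where "Q k = (G (t\<^sub>0 + k) u\<^sub>0 - G t\<^sub>0 u\<^sub>0) / k" for k
  have "Q \<midarrow>0\<rightarrow> ?g0" using deriv[OF t\<^sub>0 u\<^sub>0] by (simp add: DERIV_def Q_def[abs_def])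
  then obtain s\<^sub>2 where "s\<^sub>2 > 0" and s\<^sub>2: "\<And>k. k \<noteq> 0 \<Longrightarrow> \<bar>k\<bar> < s\<^sub>2 \<Longrightarrow> \<bar>Q k - ?g0\<bar> < \<eta> / 4"
    using \<open>\<eta> > 0\<close> unfolding LIM_eq by (metis diff_zero divide_pos_pos real_norm_def zero_less_numeral)
  define h where "h = min t\<^sub>0 (min s\<^sub>1 s\<^sub>2) / 4"
  have h: "h > 0" "2 * h < t\<^sub>0" "2 * h < s\<^sub>1" "2 * h < s\<^sub>2"
    using t\<^sub>0 \<open>s\<^sub>1 > 0\<close> \<open>s\<^sub>2 > 0\<close> by (auto simp: h_def)
  \<comment> \<open>As h tends to 0, this quotient over the interval from h to 2 h beside the point tends to the derivative at the point itself.\<close>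
  define D where "D u = \<sigma> * (G (t\<^sub>0 + \<sigma> * (2 * h)) u - G (t\<^sub>0 + \<sigma> * h) u) / h" for u
  have pos: "t\<^sub>0 + \<sigma> * z > 0" if "0 \<le> z" "z \<le> 2 * h" for z
    using \<sigma> that h by auto
  have "D u\<^sub>0 = 2 * Q (\<sigma> * (2 * h)) - Q (\<sigma> * h)"
    using \<sigma> h by (auto simp: D_def Q_def field_simps)
  moreover have "\<bar>Q (\<sigma> * (2 * h)) - ?g0\<bar> < \<eta> / 4" "\<bar>Q (\<sigma> * h) - ?g0\<bar> < \<eta> / 4"
    by (rule s\<^sub>2; use h \<sigma>2 in \<open>simp add: abs_mult\<close>)+
  ultimately have D0: "\<bar>D u\<^sub>0 - ?g0\<bar> < \<eta>" by linarith
  have slice: "continuous_on S (G t)" if "t > 0" for t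
  proof -
    have "continuous_on S ((\<lambda>(t, u). G t u) \<circ> (\<lambda>u. (t, u)))"
      using that by (intro continuous_on_compose continuous_on_subset[OF cont] continuous_intros) auto
    then show ?thesis by (simp add: o_def)
  qed
  have "continuous_on S D"
    unfolding D_def using pos[of "2 * h"] pos[of h] h by (intro continuous_intros slice) auto
  then obtain \<delta> where "\<delta> > 0" and \<delta>: "\<And>u. u \<in> S \<Longrightarrow> dist u u\<^sub>0 < \<delta> \<Longrightarrow> \<bar>D u - D u\<^sub>0\<bar> < \<eta> - \<bar>D u\<^sub>0 - ?g0\<bar>"
    using u\<^sub>0 D0 unfolding continuous_on_iff dist_real_def by (meson diff_gt_0_iff_gt)
  show ?thesis
  proof
    fix u assume u: "u \<in> S" "dist u u\<^sub>0 < \<delta>"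
    have "\<exists>z. h < z \<and> z < 2 * h \<and>
        G (t\<^sub>0 + \<sigma> * (2 * h)) u - G (t\<^sub>0 + \<sigma> * h) u = (2 * h - h) * (\<sigma> * g (t\<^sub>0 + \<sigma> * z) u)"
    proof (rule MVT2)
      fix z assume "h \<le> z" "z \<le> 2 * h"
      then have "((\<lambda>s. G s u) has_real_derivative g (t\<^sub>0 + \<sigma> * z) u) (at (t\<^sub>0 + \<sigma> * z))"
        using pos[of z] h u by (intro deriv) auto
      moreover have "((\<lambda>z. t\<^sub>0 + \<sigma> * z) has_real_derivative \<sigma>) (at z)"
        by (auto intro!: derivative_eq_intros)
      ultimately have "((\<lambda>z. G (t\<^sub>0 + \<sigma> * z) u) has_real_derivative g (t\<^sub>0 + \<sigma> * z) u * \<sigma>) (at z)"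
        by (rule DERIV_chain2[where f = "\<lambda>s. G s u"])
      then show "((\<lambda>z. G (t\<^sub>0 + \<sigma> * z) u) has_real_derivative \<sigma> * g (t\<^sub>0 + \<sigma> * z) u) (at z)"
        by (simp add: mult.commute)
    qed (use h in auto)
    then obtain z where z: "h < z" "z < 2 * h"
      and eq: "G (t\<^sub>0 + \<sigma> * (2 * h)) u - G (t\<^sub>0 + \<sigma> * h) u = h * (\<sigma> * g (t\<^sub>0 + \<sigma> * z) u)" by auto
    have "D u = g (t\<^sub>0 + \<sigma> * z) u"
      unfolding D_def eq using h \<sigma> by auto
    then have "\<bar>g (t\<^sub>0 + \<sigma> * z) u - ?g0\<bar> < \<eta>" using \<delta>[OF u] by linarith
    moreover have "\<bar>q (t\<^sub>0 + \<sigma> * z) - ?q0\<bar> < \<eta>"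
      using z h \<sigma>2 by (intro s\<^sub>1) (simp add: abs_mult)
    ultimately show "\<exists>z. h < z \<and> z < 2 * h \<and>
        \<bar>g (t\<^sub>0 + \<sigma> * z) u / q (t\<^sub>0 + \<sigma> * z) - ?g0 / ?q0\<bar> < \<epsilon>"
      using z \<eta> by blast
  qed (use h \<open>\<delta> > 0\<close> in auto)
qed

text \<open>
  Intervals on both sides of \<open>t\<^sub>0\<close> bound the monotone function \<open>g t u / q t\<close> near
  \<open>(t\<^sub>0, u\<^sub>0)\<close> from above and from below.
\<close>
lemma partial_derivative_jointly_continuous:
  fixes G g :: "real \<Rightarrow> 'a::metric_space \<Rightarrow> real" and q :: "real \<Rightarrow> real"
  assumes cont: "continuous_on ({0<..} \<times> S) (\<lambda>(t, u). G t u)"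
    and deriv: "\<And>t u. t > 0 \<Longrightarrow> u \<in> S \<Longrightarrow> ((\<lambda>s. G s u) has_real_derivative g t u) (at t)"
    and q: "continuous_on {0<..} q" "\<And>t. t > 0 \<Longrightarrow> q t > 0"
    and decr: "\<And>s t u. 0 < s \<Longrightarrow> s < t \<Longrightarrow> u \<in> S \<Longrightarrow> g t u / q t \<le> g s u / q s"
  shows "continuous_on ({0<..} \<times> S) (\<lambda>(t, u). g t u)"
proof -
  define p where "p t u = g t u / q t" for t u
  have decr': "p t u \<le> p s u" if "0 < s" "s < t" "u \<in> S" for s t u
    using decr[OF that] by (simp add: p_def)
  have "continuous_on ({0<..} \<times> S) (\<lambda>(t, u). p t u)"
    unfolding continuous_on_iff
  proof (intro ballI allI impI)
    fix x\<^sub>0 :: "real \<times> 'a" and \<epsilon> :: real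
    assume x0: "x\<^sub>0 \<in> {0<..} \<times> S" and "\<epsilon> > 0"
    then obtain t\<^sub>0 u\<^sub>0 where x0_eq: "x\<^sub>0 = (t\<^sub>0, u\<^sub>0)" and t0: "t\<^sub>0 > 0" and u0: "u\<^sub>0 \<in> S" by auto
    note beside = derivative_value_beside[OF cont deriv q t0 u0 _ \<open>\<epsilon> > 0\<close>, folded p_def]
    obtain h1 d1 where 1: "0 < h1" "2 * h1 < t\<^sub>0" "0 < d1"
      "\<And>u. u \<in> S \<Longrightarrow> dist u u\<^sub>0 < d1 \<Longrightarrow> \<exists>z. h1 < z \<and> z < 2 * h1 \<and> \<bar>p (t\<^sub>0 + 1 * z) u - p t\<^sub>0 u\<^sub>0\<bar> < \<epsilon>"
      by (rule beside[of 1]) auto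
    obtain h2 d2 where 2: "0 < h2" "2 * h2 < t\<^sub>0" "0 < d2"
      "\<And>u. u \<in> S \<Longrightarrow> dist u u\<^sub>0 < d2 \<Longrightarrow> \<exists>z. h2 < z \<and> z < 2 * h2 \<and> \<bar>p (t\<^sub>0 + (-1) * z) u - p t\<^sub>0 u\<^sub>0\<bar> < \<epsilon>"
      by (rule beside[of "-1"]) auto
    define d where "d = min (min h1 h2) (min d1 d2)"
    have "dist (case x of (t, u) \<Rightarrow> p t u) (case x\<^sub>0 of (t, u) \<Rightarrow> p t u) < \<epsilon>"
      if x: "x \<in> {0<..} \<times> S" "dist x x\<^sub>0 < d" for x
    proof -
      obtain t u where xe: "x = (t, u)" "t > 0" "u \<in> S" using x by auto
      have dt: "\<bar>t - t\<^sub>0\<bar> < d" and du: "dist u u\<^sub>0 < d"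
        using x(2) dist_fst_le[of x x\<^sub>0] dist_snd_le[of x x\<^sub>0] by (auto simp: xe x0_eq dist_real_def)
      obtain z1 where z1: "h1 < z1" "\<bar>p (t\<^sub>0 + z1) u - p t\<^sub>0 u\<^sub>0\<bar> < \<epsilon>"
        using 1(4)[of u] du xe by (auto simp: d_def)
      obtain z2 where z2: "h2 < z2" "z2 < 2 * h2" "\<bar>p (t\<^sub>0 - z2) u - p t\<^sub>0 u\<^sub>0\<bar> < \<epsilon>"
        using 2(4)[of u] du xe by (auto simp: d_def)
      have "p (t\<^sub>0 + z1) u \<le> p t u"
        using dt z1(1) xe by (intro decr') (auto simp: d_def)
      moreover have "p t u \<le> p (t\<^sub>0 - z2) u"
        using dt z2 2 xe by (intro decr') (auto simp: d_def)
      ultimately show ?thesis using z1 z2 by (simp add: xe x0_eq dist_real_def)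
    qed
    moreover have "d > 0" using 1 2 by (simp add: d_def)
    ultimately show "\<exists>d>0. \<forall>x'\<in>{0<..} \<times> S. dist x' x\<^sub>0 < d \<longrightarrow>
        dist (case x' of (t, u) \<Rightarrow> p t u) (case x\<^sub>0 of (t, u) \<Rightarrow> p t u) < \<epsilon>" by blast
  qed
  then have "continuous_on ({0<..} \<times> S) (\<lambda>x. (\<lambda>(t, u). p t u) x * q (fst x))"
    by (intro continuous_intros continuous_on_compose2[OF q(1)]) auto
  then show ?thesis
    by (rule continuous_on_eq) (use q(2) in \<open>force simp: p_def\<close>)
qed

section \<open>Uniqueness of normals in almost all directions\<close>

text \<open>
  Averaging over translations in the direction e turns the measure of A into an integral of
  the measures of its sections in that direction.
\<close>
lemma null_sets_if_countable_sections:
  fixes A :: "'a::euclidean_space set"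
  assumes A: "A \<in> sets borel" and count: "\<And>x. countable {t. x + t *\<^sub>R e \<in> A}"
  shows "A \<in> null_sets lborel"
proof -
  have [measurable]: "A \<in> sets borel" by (rule A)
  have trans: "(\<integral>\<^sup>+x. indicator A (x + t *\<^sub>R e) \<partial>lborel) = emeasure lborel A" for t :: real
  proof -
    have "(\<integral>\<^sup>+x. indicator A (x + t *\<^sub>R e) \<partial>lborel) = (\<integral>\<^sup>+x. indicator A x \<partial>distr lborel borel ((+) (t *\<^sub>R e)))"
      by (subst nn_integral_distr) (auto simp: add.commute)
    also have "distr lborel borel ((+) (t *\<^sub>R e)) = lborel"
      by (rule lborel_distr_plus)
    finally show ?thesis by simp
  qed
  have "emeasure lborel A = (\<integral>\<^sup>+t. indicator {0..1::real} t * emeasure lborel A \<partial>lborel)"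
    by (subst nn_integral_multc) auto
  also have "\<dots> = (\<integral>\<^sup>+t. (\<integral>\<^sup>+x. indicator {0..1::real} t * indicator A (x + t *\<^sub>R e) \<partial>lborel) \<partial>lborel)"
    by (simp add: nn_integral_cmult trans)
  also have "\<dots> = (\<integral>\<^sup>+x. (\<integral>\<^sup>+t. indicator {0..1::real} t * indicator A (x + t *\<^sub>R e) \<partial>lborel) \<partial>lborel)"
    by (rule lborel_pair.Fubini') measurable
  also have "\<dots> = (\<integral>\<^sup>+(x::'a). 0 \<partial>lborel)"
  proof (rule nn_integral_cong)
    fix x
    have "{t. x + t *\<^sub>R e \<in> A} \<in> null_sets lborel"
      using count by (rule countable_imp_null_set_lborel)
    then have "AE t in lborel. indicator {0..1::real} t * indicator A (x + t *\<^sub>R e) = (0::ennreal)"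
      by (rule AE_not_in[THEN eventually_mono]) (auto simp: indicator_def)
    then show "(\<integral>\<^sup>+t. indicator {0..1::real} t * indicator A (x + t *\<^sub>R e) \<partial>lborel) = 0"
      by (subst nn_integral_0_iff_AE) auto
  qed
  finally show ?thesis using A by (simp add: null_sets_def)
qed

definition maximal_at :: "'a::real_inner set \<Rightarrow> 'a \<Rightarrow> 'a \<Rightarrow> bool" where
  "maximal_at Q x y \<longleftrightarrow> y \<in> Q \<and> (\<forall>z\<in>Q. x \<bullet> z \<le> x \<bullet> y)"

text \<open>
  If two maximisers differ in the coordinate i, their i-th coordinates bound an open
  interval. Along a line in direction i these intervals are disjoint, since the i-th
  coordinate of the maximiser is monotone there. So each such line meets the set of vectors with
  this property countably often.
\<close>
lemma null_set_nonunique_maximiser: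
  fixes Q :: "'a::euclidean_space set"
  assumes "compact Q"
  shows "{x. \<exists>y y'. y \<noteq> y' \<and> maximal_at Q x y \<and> maximal_at Q x y'} \<in> null_sets lborel"
proof -
  \<comment> \<open>The gap 1/(m+1) makes these sets closed, hence Borel.\<close>
  define D where "D i m = {x. \<exists>p. p \<in> Q \<times> Q \<and> maximal_at Q x (fst p) \<and> maximal_at Q x (snd p) \<and>
      fst p \<bullet> i + 1 / real (Suc m) \<le> snd p \<bullet> i}" for i :: 'a and m :: nat
  have closed: "closed (D i m)" for i m
  proof -
    define T where "T = (\<Inter>z\<in>Q. {w :: ('a \<times> 'a) \<times> 'a. snd w \<bullet> z \<le> snd w \<bullet> fst (fst w)}
        \<inter> {w. snd w \<bullet> z \<le> snd w \<bullet> snd (fst w)}) \<inter> {w. fst (fst w) \<bullet> i + 1 / real (Suc m) \<le> snd (fst w) \<bullet> i}"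
    have "closed T"
      unfolding T_def by (intro closed_Int closed_INT ballI closed_Collect_le continuous_intros)
    then have "closed {x. \<exists>p. p \<in> Q \<times> Q \<and> (p, x) \<in> T}"
      using \<open>compact Q\<close> by (intro closed_compact_projection compact_Times)
    also have "{x. \<exists>p. p \<in> Q \<times> Q \<and> (p, x) \<in> T} = D i m"
      unfolding D_def T_def maximal_at_def by (intro Collect_cong ex_cong) auto
    finally show ?thesis .
  qed
  have "D i m \<in> null_sets lborel" if i: "i \<in> Basis" for i m
  proof (rule null_sets_if_countable_sections)
    show "D i m \<in> sets borel" using closed by (rule borel_closed)
    fix x
    define T where "T = {t. x + t *\<^sub>R i \<in> D i m}"
    have "\<exists>y y' r. maximal_at Q (x + t *\<^sub>R i) y \<and> maximal_at Q (x + t *\<^sub>R i) y' \<and>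
        r \<in> \<rat> \<and> y \<bullet> i < r \<and> r < y' \<bullet> i" if tT: "t \<in> T" for t
    proof -
      obtain y y' where "maximal_at Q (x + t *\<^sub>R i) y" "maximal_at Q (x + t *\<^sub>R i) y'"
        "y \<bullet> i + 1 / real (Suc m) \<le> y' \<bullet> i"
        using tT by (auto simp: T_def D_def)
      moreover have "0 < 1 / real (Suc m)" by simp
      ultimately show ?thesis
        using Rats_dense_in_real[of "y \<bullet> i" "y' \<bullet> i"] by (metis add_less_cancel_left add.right_neutral order_less_le_trans)
    qed
    then obtain Y Y' r where Y: "\<And>t. t \<in> T \<Longrightarrow> maximal_at Q (x + t *\<^sub>R i) (Y t) \<and>
        maximal_at Q (x + t *\<^sub>R i) (Y' t) \<and> r t \<in> \<rat> \<and> Y t \<bullet> i < r t \<and> r t < Y' t \<bullet> i" by metis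
    have mono: "r s < r t" if st: "s \<in> T" "t \<in> T" "s < t" for s t
    proof -
      have "(x + s *\<^sub>R i) \<bullet> Y t \<le> (x + s *\<^sub>R i) \<bullet> Y' s" "(x + t *\<^sub>R i) \<bullet> Y' s \<le> (x + t *\<^sub>R i) \<bullet> Y t"
        using Y[OF st(1)] Y[OF st(2)] by (auto simp: maximal_at_def)
      then have "(t - s) * (Y' s \<bullet> i) \<le> (t - s) * (Y t \<bullet> i)"
        by (simp add: inner_add_left inner_commute algebra_simps)
      then have "Y' s \<bullet> i \<le> Y t \<bullet> i" using st by simp
      then show ?thesis using Y[OF st(1)] Y[OF st(2)] by linarith
    qed
    have "inj_on r T"
      by (rule inj_onI) (metis less_irrefl linorder_neqE mono)
    moreover have "countable (r ` T)"
      using Y by (intro countable_subset[OF _ countable_rat]) auto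
    ultimately show "countable {t. x + t *\<^sub>R i \<in> D i m}"
      unfolding T_def[symmetric] by (metis countable_image_inj_on)
  qed
  then have "(\<Union>i\<in>Basis. \<Union>m. D i m) \<in> null_sets lborel"
    by (intro null_sets_UN' null_sets_UN) (auto intro: countable_finite)
  also have "(\<Union>i\<in>Basis. \<Union>m. D i m) = {x. \<exists>y y'. y \<noteq> y' \<and> maximal_at Q x y \<and> maximal_at Q x y'}"
  proof (intro equalityI subsetI)
    fix x assume "x \<in> (\<Union>i\<in>Basis. \<Union>m. D i m)"
    then obtain i m y y' where "maximal_at Q x y" "maximal_at Q x y'" "y \<bullet> i + 1 / real (Suc m) \<le> y' \<bullet> i"
      by (auto simp: D_def)
    moreover have "y \<noteq> y'"
    proof
      assume "y = y'"
      then have "1 / real (Suc m) \<le> 0" using \<open>y \<bullet> i + 1 / real (Suc m) \<le> y' \<bullet> i\<close> by simp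
      then show False by simp
    qed
    ultimately show "x \<in> {x. \<exists>y y'. y \<noteq> y' \<and> maximal_at Q x y \<and> maximal_at Q x y'}"
      by blast
  next
    fix x assume "x \<in> {x. \<exists>y y'. y \<noteq> y' \<and> maximal_at Q x y \<and> maximal_at Q x y'}"
    then obtain y y' where y: "y \<noteq> y'" "maximal_at Q x y" "maximal_at Q x y'" by blast
    then obtain i where i: "i \<in> Basis" "y \<bullet> i \<noteq> y' \<bullet> i" by (metis euclidean_eq_iff)
    obtain z z' where z: "maximal_at Q x z" "maximal_at Q x z'" "z \<bullet> i < z' \<bullet> i"
      using y i by (metis linorder_neqE)
    then obtain m where "1 / real (Suc m) < z' \<bullet> i - z \<bullet> i"
      by (meson diff_gt_0_iff_gt nat_approx_posE)
    then have "x \<in> D i m"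
      using z unfolding D_def maximal_at_def by (intro CollectI exI[of _ "(z, z')"]) auto
    then show "x \<in> (\<Union>i\<in>Basis. \<Union>m. D i m)" using i by blast
  qed
  finally show ?thesis .
qed


definition sphere_space :: "(real ^ 'n) measure" where
  "sphere_space = restrict_space sphere_measure (sphere 0 1)"

lemma sets_borel_sphere_measure: "A \<in> sets borel \<Longrightarrow> A \<in> sets sphere_measure"
  using sets_borel_hausdorff_measure unfolding sphere_measure_def by blast

lemma space_sphere_measure [simp]: "space sphere_measure = UNIV"
  by (simp add: sphere_measure_def)

lemma space_sphere_space [simp]: "space sphere_space = sphere 0 1"
  by (simp add: sphere_space_def space_restrict_space)

lemma sphere_in_sets: "sphere 0 1 \<inter> space sphere_measure \<in> sets sphere_measure"
  by (simp add: sets_borel_sphere_measure)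

lemma sets_sphere_space_iff: "A \<in> sets sphere_space \<longleftrightarrow> A \<subseteq> sphere 0 1 \<and> A \<in> sets sphere_measure"
  unfolding sphere_space_def by (rule sets_restrict_space_iff[OF sphere_in_sets])

lemma emeasure_sphere_space:
  assumes "A \<in> sets sphere_space"
  shows "emeasure (sphere_space :: (real ^ 'n) measure) A = hausdorff_outer (CARD('n) - 1) A"
  using assms unfolding sets_sphere_space_iff unfolding sphere_space_def
  by (subst emeasure_restrict_space[OF sphere_in_sets])
     (auto simp: sphere_measure_def emeasure_hausdorff_measure)

lemma complete_sphere_space: "complete_measure (sphere_space :: (real ^ 'n) measure)"
proof
  fix A B :: "(real ^ 'n) set" assume "B \<subseteq> A" "A \<in> null_sets sphere_space"
  then have A: "A \<in> sets sphere_space" "hausdorff_outer (CARD('n) - 1) A = 0"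
    by (auto simp: null_sets_def emeasure_sphere_space)
  then have "hausdorff_outer (CARD('n) - 1) B = 0"
    using hausdorff_outer_mono[OF \<open>B \<subseteq> A\<close>, of "CARD('n) - 1"] by simp
  then have "B \<in> sets sphere_measure"
    using hausdorff_null_set unfolding sphere_measure_def by blast
  then show "B \<in> sets sphere_space"
    using A(1) \<open>B \<subseteq> A\<close> by (auto simp: sets_sphere_space_iff)
qed

lemma AE_sphere_space_iff:
  "(AE u in sphere_space. P u) \<longleftrightarrow> (AE u in sphere_measure. u \<in> sphere 0 1 \<longrightarrow> P u)"
  unfolding sphere_space_def by (rule AE_restrict_space_iff[OF sphere_in_sets])

text \<open>
  Density functions are only known almost everywhere, where the normal is unique; completeness
  makes that sufficient.
\<close>
lemma measurable_AE_eq: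
  assumes "complete_measure M" and g: "g \<in> measurable M N" and eq: "AE x in M. f x = g x"
    and f: "\<And>x. x \<in> space M \<Longrightarrow> f x \<in> space N"
  shows "f \<in> measurable M N"
proof (rule measurableI)
  fix A assume "A \<in> sets N"
  then have "g -` A \<inter> space M \<in> sets M" using g by (rule measurable_sets[rotated])
  moreover have "AE x in M. x \<in> g -` A \<inter> space M \<longleftrightarrow> x \<in> f -` A \<inter> space M"
    using eq by eventually_elim auto
  ultimately show "f -` A \<inter> space M \<in> sets M"
    using complete_measure.in_sets_AE[OF assms(1)] by (metis Int_lower2)
qed (rule f)

lemma measurable_continuous_on_sphere:
  fixes f :: "real ^ 'n \<Rightarrow> 'b::topological_space"
  assumes "continuous_on (sphere 0 1) f"
  shows "f \<in> borel_measurable sphere_space"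
proof (rule borel_measurableI)
  fix T :: "'b set" assume "open T"
  then obtain U where U: "open U" "f -` T \<inter> sphere 0 1 = U \<inter> sphere 0 1"
    using assms by (metis continuous_on_open_invariant)
  then have "f -` T \<inter> sphere 0 1 \<in> sets borel" by auto
  then show "f -` T \<inter> space sphere_space \<in> sets sphere_space"
    by (simp add: sets_sphere_space_iff sets_borel_sphere_measure)
qed

lemma maximal_at_scaleR: "r > 0 \<Longrightarrow> maximal_at Q (r *\<^sub>R x) y \<longleftrightarrow> maximal_at Q x y"
  by (simp add: maximal_at_def)

text \<open>
  Two normals at \<open>\<rho>\<^sub>K(u) u\<close> give two maximisers of u over the polar body. The vectors with
  several maximisers form a Lebesgue null cone, which meets the sphere in a null set.
\<close>
lemma AE_unique_normal:
  fixes K :: "(real ^ 'n) set"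
  assumes K: "convex_body_o K"
  shows "AE u in sphere_space. \<exists>!v. outer_unit_normal K (radial_fun K u *\<^sub>R u) v"
proof -
  define D where "D = {x. \<exists>y y'. y \<noteq> y' \<and> maximal_at (polar_body K) x y \<and> maximal_at (polar_body K) x y'}"
  have D_null: "D \<in> null_sets lborel"
    unfolding D_def by (rule null_set_nonunique_maximiser[OF compact_polar_body[OF K]])
  have D_cone: "r *\<^sub>R x \<in> D \<longleftrightarrow> x \<in> D" if "r > 0" for r x
    using that by (simp add: D_def maximal_at_scaleR)
  let ?M = "{x. 1 \<le> norm x \<and> norm x \<le> 2 \<and> (1 / norm x) *\<^sub>R x \<in> D \<inter> sphere 0 1}"
  have "x \<in> ?M \<longleftrightarrow> x \<in> D \<inter> (cball 0 2 - ball 0 1)" for x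
  proof (cases "1 \<le> norm x")
    case True
    then have "norm x > 0" "x \<noteq> 0" by auto
    with True show ?thesis using D_cone[of "1 / norm x" x] by auto
  qed auto
  then have "?M = D \<inter> (cball 0 2 - ball 0 1)" by blast
  moreover have "D \<inter> (cball 0 2 - ball 0 1) \<in> null_sets lborel"
    by (rule null_set_Int2[OF D_null]) auto
  ultimately have "?M \<in> null_sets lborel" by simp
  then have "hausdorff_outer (DIM(real ^ 'n) - 1) (D \<inter> sphere 0 1) = 0"
    by (rule hausdorff_outer_zero_if_shell_null[rotated]) auto
  then have "D \<inter> sphere 0 1 \<in> null_sets sphere_measure"
    using hausdorff_null_set unfolding sphere_measure_def by simp
  then have "AE u in sphere_measure. u \<notin> D \<inter> sphere 0 1" by (rule AE_not_in)
  then have "AE u in sphere_measure. u \<in> sphere 0 1 \<longrightarrow> (\<exists>!v. outer_unit_normal K (radial_fun K u *\<^sub>R u) v)"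
  proof eventually_elim
    case (elim u)
    show ?case
    proof
      assume "u \<in> sphere 0 1"
      then have u: "norm u = 1" "u \<notin> D" using elim by auto
      let ?N = "outer_unit_normal K (radial_fun K u *\<^sub>R u)"
      have "v = w" if v: "?N v" and w: "?N w" for v w
      proof -
        have "maximal_at (polar_body K) u ((1 / support_fun K z) *\<^sub>R z)" if "?N z" for z
          using scaled_normal_in_polar_body[OF K u(1) that] inner_le_support_fun[OF compact_polar_body[OF K]]
          by (auto simp: maximal_at_def)
        then have eq: "(1 / support_fun K v) *\<^sub>R v = (1 / support_fun K w) *\<^sub>R w"
          using u(2) v w by (auto simp: D_def)
        note nv = outer_unit_normalD(1)[OF K u(1) v] and nw = outer_unit_normalD(1)[OF K u(1) w]
        have pos: "support_fun K v > 0" "support_fun K w > 0"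
          using nv nw by (auto intro!: support_fun_pos[OF K])
        have "norm ((1 / support_fun K v) *\<^sub>R v) = norm ((1 / support_fun K w) *\<^sub>R w)" using eq by simp
        then have "support_fun K v = support_fun K w" using pos nv nw by simp
        then show ?thesis using eq pos by simp
      qed
      then show "\<exists>!v. ?N v" using outer_unit_normal_exists[OF K u(1)] by blast
    qed
  qed
  then show ?thesis by (simp add: AE_sphere_space_iff)
qed

lemma radial_gauss_map_eqI:
  assumes "\<exists>!v. outer_unit_normal K (radial_fun K u *\<^sub>R u) v"
  shows "outer_unit_normal K (radial_fun K u *\<^sub>R u) v \<longleftrightarrow> v = radial_gauss_map K u"
  using theI'[OF assms] assms unfolding radial_gauss_map_def by metis

lemma AE_radial_gauss_map:
  assumes "convex_body_o K"
  shows "AE u in sphere_space. norm u = 1 \<and>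
    (\<forall>v. outer_unit_normal K (radial_fun K u *\<^sub>R u) v \<longleftrightarrow> v = radial_gauss_map K u)"
  using AE_unique_normal[OF assms] AE_space
  by eventually_elim (simp add: radial_gauss_map_eqI)

text \<open>
  Where the normal is unique it depends continuously on the direction, since being a normal is a
  closed condition and normals range over a compact set. The remaining directions form a null set.
\<close>
lemma measurable_radial_gauss_map:
  fixes K :: "(real ^ 'n) set"
  assumes K: "convex_body_o K"
  shows "radial_gauss_map K \<in> borel_measurable sphere_space"
proof -
  let ?N = "\<lambda>u. outer_unit_normal K (radial_fun K u *\<^sub>R u)"
  define R where "R = {u \<in> sphere 0 1. \<exists>!v. ?N u v}"
  interpret complete_measure "sphere_space :: (real ^ 'n) measure" by (rule complete_sphere_space)
  have "AE u in sphere_space. u \<notin> sphere 0 1 - R"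
    using AE_unique_normal[OF K] by eventually_elim (simp add: R_def)
  then have null: "sphere 0 1 - R \<in> null_sets sphere_space"
    by (simp add: null_sets_iff_AE)
  then have "sphere 0 1 - (sphere 0 1 - R) \<in> sets sphere_space"
    using sets.compl_sets[of "sphere 0 1 - R" "sphere_space"] by (auto simp: null_sets_def)
  moreover have "sphere 0 1 - (sphere 0 1 - R) = R" by (auto simp: R_def)
  ultimately have R: "R \<in> sets sphere_space" by metis
  have "continuous_on R (radial_gauss_map K)"
  proof (subst continuous_closed_graph_eq)
    show "compact (sphere 0 1 :: (real ^ 'n) set)" by simp
    show "radial_gauss_map K \<in> R \<rightarrow> sphere 0 1"
    proof
      fix u assume "u \<in> R"
      then have "?N u (radial_gauss_map K u)" by (simp add: R_def radial_gauss_map_eqI)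
      then show "radial_gauss_map K u \<in> sphere 0 1" by (simp add: outer_unit_normal_def)
    qed
    define Z where "Z = {z \<in> sphere 0 1 \<times> sphere 0 1. snd z \<bullet> (radial_fun K (fst z) *\<^sub>R fst z) - support_fun K (snd z) = 0}"
    have "closed Z"
      unfolding Z_def
      by (intro continuous_closed_preimage_constant continuous_intros closed_Times closed_sphere
          continuous_on_compose2[OF continuous_on_radial_fun[OF K]]
          continuous_on_compose2[OF continuous_on_support_fun[OF convex_body_o_D(1,5)[OF K]]]) auto
    then have "closedin (top_of_set (R \<times> sphere 0 1)) ((R \<times> sphere 0 1) \<inter> Z)"
      by (rule closedin_closed_Int)
    also have "(R \<times> sphere 0 1) \<inter> Z = {(u, v). u \<in> R \<and> ?N u v}"
      by (auto simp: R_def Z_def outer_unit_normal_def)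
    also have "\<dots> = (\<lambda>u. (u, radial_gauss_map K u)) ` R"
    proof -
      have "?N u v \<longleftrightarrow> v = radial_gauss_map K u" if "u \<in> R" for u v
        using that by (intro radial_gauss_map_eqI) (simp add: R_def)
      then show ?thesis by blast
    qed
    finally show "closedin (top_of_set (R \<times> sphere 0 1)) ((\<lambda>u. (u, radial_gauss_map K u)) ` R)" .
  qed
  note cont = this
  show ?thesis
  proof (rule borel_measurableI)
    fix T :: "(real ^ 'n) set" assume "open T"
    then obtain U where U: "open U" "U \<inter> R = radial_gauss_map K -` T \<inter> R"
      using cont[unfolded continuous_on_open_invariant] by blast
    have "U \<inter> sphere 0 1 \<in> sets sphere_space"
      using U(1) by (auto simp: sets_sphere_space_iff intro!: sets_borel_sphere_measure)
    then have "(U \<inter> sphere 0 1) \<inter> R \<in> sets sphere_space" using R by blast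
    moreover have "(U \<inter> sphere 0 1) \<inter> R = radial_gauss_map K -` T \<inter> R"
      using U(2) by (auto simp: R_def)
    ultimately have 1: "radial_gauss_map K -` T \<inter> R \<in> sets sphere_space" by simp
    have 2: "radial_gauss_map K -` T \<inter> (sphere 0 1 - R) \<in> sets sphere_space"
      by (rule complete[OF _ null]) auto
    have "radial_gauss_map K -` T \<inter> space sphere_space
        = (radial_gauss_map K -` T \<inter> R) \<union> (radial_gauss_map K -` T \<inter> (sphere 0 1 - R))"
      by (auto simp: R_def)
    then show "radial_gauss_map K -` T \<inter> space sphere_space \<in> sets sphere_space"
      using sets.Un[OF 1 2] by simp
  qed
qed

section \<open>The curvature measure as an image under the Gauss map\<close>

text \<open>
  Here g stands for \<open>\<bar>G\<^sub>t\<bar>\<close>, so that the density is positive under both conditions of the theorem.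
\<close>
definition curvature_density ::
    "(real \<Rightarrow> real ^ 'n \<Rightarrow> real) \<Rightarrow> (real \<Rightarrow> real) \<Rightarrow> (real ^ 'n) set \<Rightarrow> real ^ 'n \<Rightarrow> real" where
  "curvature_density g \<psi> K u =
     radial_fun K u * g (radial_fun K u) u / \<psi> (support_fun K (radial_gauss_map K u))"

text \<open>
  The dual curvature measure up to a constant factor, in a form in which functions of the normal can be
  integrated.
\<close>
definition normal_measure ::
    "(real \<Rightarrow> real ^ 'n \<Rightarrow> real) \<Rightarrow> (real \<Rightarrow> real) \<Rightarrow> (real ^ 'n) set \<Rightarrow> (real ^ 'n) measure" where
  "normal_measure g \<psi> K =
     distr (density sphere_space (\<lambda>u. ennreal (curvature_density g \<psi> K u))) borel (radial_gauss_map K)"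

lemma AE_radial_gauss_map_normal:
  assumes "convex_body_o K"
  shows "AE u in sphere_space. norm u = 1 \<and> norm (radial_gauss_map K u) = 1 \<and>
    outer_unit_normal K (radial_fun K u *\<^sub>R u) (radial_gauss_map K u)"
  using AE_radial_gauss_map[OF assms] by eventually_elim (auto simp: outer_unit_normal_def)

lemma continuous_on_psi_support:
  fixes K :: "(real ^ 'n) set"
  assumes K: "convex_body_o K" and psi: "continuous_on {0<..} \<psi>"
  shows "continuous_on (sphere 0 1) (\<lambda>v. \<psi> (support_fun K v))"
proof (rule continuous_on_compose2[OF psi])
  show "continuous_on (sphere 0 1) (support_fun K)"
    by (rule continuous_on_support_fun[OF convex_body_o_D(1,5)[OF K]])
  show "support_fun K ` sphere 0 1 \<subseteq> {0<..}"
  proof (rule image_subsetI)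
    fix v :: "real ^ 'n" assume "v \<in> sphere 0 1"
    then have "v \<noteq> 0" by auto
    then show "support_fun K v \<in> {0<..}" using support_fun_pos[OF K] by simp
  qed
qed

lemma continuous_on_sphere_bounded:
  fixes f :: "'a::euclidean_space \<Rightarrow> real"
  assumes "continuous_on (sphere 0 1) f"
  shows "\<exists>B. \<forall>v. norm v = 1 \<longrightarrow> \<bar>f v\<bar> \<le> B"
proof -
  have "bounded (f ` sphere 0 1)"
    using compact_continuous_image[OF assms] by (simp add: compact_imp_bounded)
  then obtain B where "\<forall>y\<in>f ` sphere 0 1. norm y \<le> B" unfolding bounded_iff by blast
  then show ?thesis by (intro exI[of _ B]) auto
qed

text \<open>
  The factor \<open>\<rho> / \<psi>(h)\<close> is bounded by compactness, so integrability is inherited from g.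
\<close>
lemma integrable_curvature_density:
  fixes K :: "(real ^ 'n) set"
  assumes K: "convex_body_o K" and psi_pos: "\<And>s. s > 0 \<Longrightarrow> \<psi> s > 0" and psi: "continuous_on {0<..} \<psi>"
    and int: "integrable sphere_space (\<lambda>u. g (radial_fun K u) u)"
  shows "integrable sphere_space (curvature_density g \<psi> K)"
proof -
  define k where "k v = indicator (sphere 0 1) v *\<^sub>R (1 / \<psi> (support_fun K v))" for v
  have pos: "\<psi> (support_fun K v) > 0" if "norm v = 1" for v
    using that by (intro psi_pos support_fun_pos[OF K]) auto
  have cont: "continuous_on (sphere 0 1) (\<lambda>v. 1 / \<psi> (support_fun K v))"
    using pos by (intro continuous_intros continuous_on_psi_support[OF K psi]) fastforce
  then have [measurable]: "k \<in> borel_measurable borel"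
    unfolding k_def by (intro borel_measurable_continuous_on_indicator) auto
  have [measurable]: "radial_fun K \<in> borel_measurable sphere_space"
    by (rule measurable_continuous_on_sphere[OF continuous_on_radial_fun[OF K]])
  have [measurable]: "radial_gauss_map K \<in> borel_measurable sphere_space"
    by (rule measurable_radial_gauss_map[OF K])
  note [measurable] = borel_measurable_integrable[OF int]
  have eq: "AE u in sphere_space. curvature_density g \<psi> K u = (radial_fun K u * k (radial_gauss_map K u)) * g (radial_fun K u) u"
    using AE_radial_gauss_map_normal[OF K] by eventually_elim (simp add: curvature_density_def k_def)
  have meas: "curvature_density g \<psi> K \<in> borel_measurable sphere_space"
    by (rule measurable_AE_eq[OF complete_sphere_space _ eq]) auto
  obtain A where A: "\<And>u. norm u = 1 \<Longrightarrow> \<bar>radial_fun K u\<bar> \<le> A"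
    using continuous_on_sphere_bounded[OF continuous_on_radial_fun[OF K]] by blast
  obtain B where B: "\<And>v. norm v = 1 \<Longrightarrow> \<bar>1 / \<psi> (support_fun K v)\<bar> \<le> B"
    using continuous_on_sphere_bounded[OF cont] by blast
  have "integrable sphere_space (\<lambda>u. (A * B) * g (radial_fun K u) u)"
    using int by (rule integrable_mult_right)
  then show ?thesis
  proof (rule Bochner_Integration.integrable_bound[OF _ meas])
    show "AE u in sphere_space. norm (curvature_density g \<psi> K u) \<le> norm ((A * B) * g (radial_fun K u) u)"
      using AE_radial_gauss_map_normal[OF K] eq
    proof eventually_elim
      case (elim u)
      have "\<bar>radial_fun K u\<bar> * \<bar>k (radial_gauss_map K u)\<bar> \<le> \<bar>A * B\<bar>"
      proof -
        have "\<bar>radial_fun K u\<bar> \<le> A" "\<bar>k (radial_gauss_map K u)\<bar> \<le> B" "0 \<le> A"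
          using A[of u] B[of "radial_gauss_map K u"] elim(1) by (auto simp: k_def)
        then have "\<bar>radial_fun K u\<bar> * \<bar>k (radial_gauss_map K u)\<bar> \<le> A * B"
          by (intro mult_mono) auto
        then show ?thesis by simp
      qed
      then have "\<bar>radial_fun K u\<bar> * \<bar>k (radial_gauss_map K u)\<bar> * \<bar>g (radial_fun K u) u\<bar> \<le> \<bar>A * B\<bar> * \<bar>g (radial_fun K u) u\<bar>"
        by (rule mult_right_mono) simp
      then show ?case unfolding elim(2) by (simp add: abs_mult)
    qed
  qed
qed

lemma nn_integral_normal_measure:
  assumes K: "convex_body_o K" and dens: "curvature_density g \<psi> K \<in> borel_measurable sphere_space"
    and f: "f \<in> borel_measurable borel"
  shows "(\<integral>\<^sup>+v. f v \<partial>normal_measure g \<psi> K) =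
    (\<integral>\<^sup>+u. ennreal (curvature_density g \<psi> K u) * f (radial_gauss_map K u) \<partial>sphere_space)"
proof -
  note [measurable] = measurable_radial_gauss_map[OF K] dens f
  show ?thesis
    unfolding normal_measure_def by (simp add: nn_integral_distr nn_integral_density)
qed

text \<open>
  Where the normal is unique, u lies in the reverse radial Gauss image of E exactly if the
  Gauss map sends u into E.
\<close>
lemma dual_curvature_measure_eq_integral:
  fixes K :: "(real ^ 'n) set"
  assumes K: "convex_body_o K" and E: "E \<in> sets borel" "E \<subseteq> sphere 0 1"
    and dens: "curvature_density g \<psi> K \<in> borel_measurable sphere_space"
    and sg: "\<And>t u. t > 0 \<Longrightarrow> norm u = 1 \<Longrightarrow> partial_t G t u = sg * g t u"
  shows "dual_curvature_measure G \<psi> K E =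
    sg / real CARD('n) * (\<integral>u. curvature_density g \<psi> K u * indicator E (radial_gauss_map K u) \<partial>sphere_space)"
proof -
  let ?A = "reverse_radial_gauss_image K E"
  let ?f = "\<lambda>u. radial_fun K u * partial_t G (radial_fun K u) u / \<psi> (support_fun K (radial_gauss_map K u))"
  let ?rhs = "\<lambda>u. sg * (curvature_density g \<psi> K u * indicator E (radial_gauss_map K u))"
  note [measurable] = measurable_radial_gauss_map[OF K] dens E(1)
  have "(LINT u:?A|sphere_measure. ?f u) = (\<integral>u. indicator (sphere 0 1) u *\<^sub>R (indicator ?A u *\<^sub>R ?f u) \<partial>sphere_measure)"
    unfolding set_lebesgue_integral_def
    by (intro Bochner_Integration.integral_cong) (auto simp: reverse_radial_gauss_image_def indicator_def)
  also have "\<dots> = (\<integral>u. indicator ?A u *\<^sub>R ?f u \<partial>sphere_space)"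
    unfolding sphere_space_def by (rule integral_restrict_space[OF sphere_in_sets, symmetric])
  also have "\<dots> = (\<integral>u. ?rhs u \<partial>sphere_space)"
  proof -
    have eq: "AE u in sphere_space. indicator ?A u *\<^sub>R ?f u = ?rhs u"
      using AE_radial_gauss_map[OF K]
    proof eventually_elim
      case (elim u)
      then have "u \<in> ?A \<longleftrightarrow> radial_gauss_map K u \<in> E"
        by (auto simp: reverse_radial_gauss_image_def)
      moreover have "?f u = sg * curvature_density g \<psi> K u"
        using elim sg[OF radial_fun_mem_upper(1)[OF K], of u u] by (simp add: curvature_density_def)
      ultimately show ?case by (simp add: indicator_def)
    qed
    have "?rhs \<in> borel_measurable sphere_space" by measurable
    moreover from this have "(\<lambda>u. indicator ?A u *\<^sub>R ?f u) \<in> borel_measurable sphere_space"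
      by (rule measurable_AE_eq[OF complete_sphere_space _ eq]) auto
    ultimately show ?thesis using eq by (intro integral_cong_AE)
  qed
  finally show ?thesis by (simp add: dual_curvature_measure_def)
qed

lemma normal_measure_eqI:
  fixes K K' :: "(real ^ 'n) set"
  assumes K: "convex_body_o K" and K': "convex_body_o K'"
    and int: "integrable sphere_space (curvature_density g \<psi> K)" "integrable sphere_space (curvature_density g \<psi> K')"
    and nonneg: "AE u in sphere_space. 0 \<le> curvature_density g \<psi> K u" "AE u in sphere_space. 0 \<le> curvature_density g \<psi> K' u"
    and sg: "\<And>t u. t > 0 \<Longrightarrow> norm u = 1 \<Longrightarrow> partial_t G t u = sg * g t u" "sg \<noteq> 0"
    and eq: "\<And>E. E \<in> sets borel \<Longrightarrow> E \<subseteq> sphere 0 1 \<Longrightarrow>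
      dual_curvature_measure G \<psi> K E = dual_curvature_measure G \<psi> K' E"
  shows "normal_measure g \<psi> K = normal_measure g \<psi> K'"
proof (rule measure_eqI)
  show "sets (normal_measure g \<psi> K) = sets (normal_measure g \<psi> K')" by (simp add: normal_measure_def)
  fix E assume "E \<in> sets (normal_measure g \<psi> K)"
  then have E: "E \<in> sets borel" by (simp add: normal_measure_def)
  define E' where "E' = E \<inter> sphere 0 1"
  have E': "E' \<in> sets borel" "E' \<subseteq> sphere 0 1" using E by (auto simp: E'_def)
  have emeas: "emeasure (normal_measure g \<psi> L) E =
      ennreal (\<integral>u. curvature_density g \<psi> L u * indicator E' (radial_gauss_map L u) \<partial>sphere_space)"
    if L: "convex_body_o L" and int: "integrable sphere_space (curvature_density g \<psi> L)"
      and nonneg: "AE u in sphere_space. 0 \<le> curvature_density g \<psi> L u" for L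
  proof -
    note [measurable] = measurable_radial_gauss_map[OF L] borel_measurable_integrable[OF int] E'(1)
    have "emeasure (normal_measure g \<psi> L) E = (\<integral>\<^sup>+v. indicator E v \<partial>normal_measure g \<psi> L)"
      using E by (simp add: normal_measure_def)
    also have "\<dots> = (\<integral>\<^sup>+u. ennreal (curvature_density g \<psi> L u) * indicator E (radial_gauss_map L u) \<partial>sphere_space)"
      using E by (intro nn_integral_normal_measure[OF L]) auto
    also have "\<dots> = (\<integral>\<^sup>+u. ennreal (curvature_density g \<psi> L u * indicator E' (radial_gauss_map L u)) \<partial>sphere_space)"
    proof (rule nn_integral_cong_AE)
      show "AE u in sphere_space. ennreal (curvature_density g \<psi> L u) * indicator E (radial_gauss_map L u)
          = ennreal (curvature_density g \<psi> L u * indicator E' (radial_gauss_map L u))"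
        using AE_radial_gauss_map_normal[OF L] by eventually_elim (simp add: E'_def indicator_def)
    qed
    also have "\<dots> = ennreal (\<integral>u. curvature_density g \<psi> L u * indicator E' (radial_gauss_map L u) \<partial>sphere_space)"
    proof (rule nn_integral_eq_integral)
      show "integrable sphere_space (\<lambda>u. curvature_density g \<psi> L u * indicator E' (radial_gauss_map L u))"
        by (rule Bochner_Integration.integrable_bound[OF int]) (auto simp: indicator_def)
      show "AE u in sphere_space. 0 \<le> curvature_density g \<psi> L u * indicator E' (radial_gauss_map L u)"
        using nonneg by eventually_elim simp
    qed
    finally show ?thesis .
  qed
  have "sg / real CARD('n) * (\<integral>u. curvature_density g \<psi> K u * indicator E' (radial_gauss_map K u) \<partial>sphere_space)
      = sg / real CARD('n) * (\<integral>u. curvature_density g \<psi> K' u * indicator E' (radial_gauss_map K' u) \<partial>sphere_space)"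
    using eq[OF E'] dual_curvature_measure_eq_integral[OF K E' borel_measurable_integrable[OF int(1)] sg(1)]
      dual_curvature_measure_eq_integral[OF K' E' borel_measurable_integrable[OF int(2)] sg(1)] by simp
  then show "emeasure (normal_measure g \<psi> K) E = emeasure (normal_measure g \<psi> K') E"
    using \<open>sg \<noteq> 0\<close> by (simp add: emeas[OF K int(1) nonneg(1)] emeas[OF K' int(2) nonneg(2)])
qed

section \<open>Comparison of two bodies with the same measure\<close>

text \<open>
  The situation to be refuted: two bodies with the same measure, the second of which reaches
  further than the first in some direction. Again g stands for \<open>\<bar>G\<^sub>t\<bar>\<close>.
\<close>
locale orlicz_pair =
  fixes g :: "real \<Rightarrow> real ^ 'n \<Rightarrow> real" and \<psi> :: "real \<Rightarrow> real" and K K' :: "(real ^ 'n) set"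
  assumes g_pos: "t > 0 \<Longrightarrow> norm u = 1 \<Longrightarrow> g t u > 0"
    and psi_pos: "s > 0 \<Longrightarrow> \<psi> s > 0"
    and psi_cont: "continuous_on {0<..} \<psi>"
    and dilation: "l > 1 \<Longrightarrow> t > 0 \<Longrightarrow> s > 0 \<Longrightarrow> norm u = 1 \<Longrightarrow>
      (l * t) * g (l * t) u / \<psi> (l * s) < t * g t u / \<psi> s"
    and K: "convex_body_o K" and K': "convex_body_o K'"
    and int_dens: "integrable sphere_space (curvature_density g \<psi> K)"
      "integrable sphere_space (curvature_density g \<psi> K')"
    and same_measure: "normal_measure g \<psi> K = normal_measure g \<psi> K'"
    and larger: "\<exists>v. norm v = 1 \<and> support_fun K v < support_fun K' v"
begin

abbreviation "h \<equiv> support_fun K"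
abbreviation "h' \<equiv> support_fun K'"
abbreviation "\<rho> \<equiv> radial_fun K"
abbreviation "\<rho>' \<equiv> radial_fun K'"
abbreviation "\<alpha> \<equiv> radial_gauss_map K"
abbreviation "\<alpha>' \<equiv> radial_gauss_map K'"
abbreviation "dens \<equiv> curvature_density g \<psi> K"
abbreviation "dens' \<equiv> curvature_density g \<psi> K'"

lemma h_pos: "norm v = 1 \<Longrightarrow> h v > 0" "norm v = 1 \<Longrightarrow> h' v > 0"
  using support_fun_pos[OF K, of v] support_fun_pos[OF K', of v] by force+

lemma cont_h: "continuous_on A h" "continuous_on A h'"
  using continuous_on_support_fun convex_body_o_D(1,5)[OF K] convex_body_o_D(1,5)[OF K'] by blast+

text \<open>
  The ratio of the support functions attains its maximum l. As K' is then contained in l K,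
  the radial functions satisfy the same inequality.
\<close>
lemma maximal_dilation:
  obtains l v where "l > 1" "norm v = 1" "h' v = l * h v" "\<And>w. norm w = 1 \<Longrightarrow> h' w \<le> l * h w"
    "\<And>u. norm u = 1 \<Longrightarrow> \<rho>' u \<le> l * \<rho> u"
proof -
  have "continuous_on (sphere 0 1) (\<lambda>v. h' v / h v)"
    using h_pos by (intro continuous_intros cont_h) fastforce
  moreover obtain v0 where v0: "norm v0 = 1" "h v0 < h' v0" using larger by blast
  ultimately obtain v where v: "norm v = 1" "\<And>w. norm w = 1 \<Longrightarrow> h' w / h w \<le> h' v / h v"
    using continuous_attains_sup[of "sphere 0 1" "\<lambda>v. h' v / h v"] by force
  define l where "l = h' v / h v"
  have l: "h' w \<le> l * h w" if "norm w = 1" for w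
    using v(2)[OF that] h_pos(1)[OF that] by (simp add: l_def[symmetric] divide_le_eq)
  have "1 < h' v0 / h v0" using v0 h_pos(1)[of v0] by simp
  then have "l > 1" using v(2)[OF v0(1)] by (simp add: l_def)
  moreover have "\<rho>' u \<le> l * \<rho> u" if u: "norm u = 1" for u
  proof (rule ccontr)
    assume "\<not> \<rho>' u \<le> l * \<rho> u"
    moreover obtain w where w: "outer_unit_normal K (\<rho> u *\<^sub>R u) w"
      using outer_unit_normal_exists[OF K u] by blast
    ultimately have "l * h w < h' w" by (intro aleksandrov_normal[OF K K' u w]) simp
    then show False using l outer_unit_normalD(1)[OF K u w] by force
  qed
  moreover have "h' v = l * h v" using h_pos(1)[OF v(1)] by (simp add: l_def)
  ultimately show ?thesis using that v(1) l by blast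
qed

definition reach :: "real \<Rightarrow> (real ^ 'n) set" where
  "reach c = {v. norm v = 1 \<and> c * h v < h' v}"

lemma borel_reach: "reach c \<in> sets borel"
proof -
  have "open {v. c * h v < h' v}"
    by (intro open_Collect_less continuous_intros cont_h)
  then have "sphere 0 1 \<inter> {v. c * h v < h' v} \<in> sets borel" by auto
  also have "sphere 0 1 \<inter> {v. c * h v < h' v} = reach c" by (auto simp: reach_def)
  finally show ?thesis .
qed

lemma AE_reach_inclusion:
  assumes "c > 0"
  shows "AE u in sphere_space. \<alpha>' u \<in> reach c \<longrightarrow> \<alpha> u \<in> reach c"
  using AE_radial_gauss_map_normal[OF K] AE_radial_gauss_map_normal[OF K']
proof eventually_elim
  case (elim u)
  then show ?case
    using aleksandrov_radial[OF K K' _ assms, of u "\<alpha>' u"] aleksandrov_normal[OF K K', of u "\<alpha> u" c]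
    by (auto simp: reach_def)
qed

text \<open>
  The directions in which K' reaches further than c K form a relatively open set, and all
  normals of K in these directions belong to reach c.
\<close>
lemma reach_not_null:
  assumes c: "c > 0" and ne: "reach c \<noteq> {}"
  shows "\<not> (AE u in sphere_space. \<alpha> u \<notin> reach c)"
proof
  assume null: "AE u in sphere_space. \<alpha> u \<notin> reach c"
  obtain v where v: "norm v = 1" "c * h v < h' v" using ne by (auto simp: reach_def)
  obtain x where x: "x \<in> K'" "v \<bullet> x = h' v"
    using support_fun_attained[OF convex_body_o_D(1,5)[OF K']] by blast
  have "v \<noteq> 0" using v by auto
  define u where "u = (1 / norm x) *\<^sub>R x"
  note xu = radial_fun_eq_if_normal[OF K' x(1) \<open>v \<noteq> 0\<close> x(2), folded u_def]
  have u: "norm u = 1" "\<rho>' u *\<^sub>R u = x" using xu by (auto simp: u_def)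
  have "outer_unit_normal K' (\<rho>' u *\<^sub>R u) v" using x v u by (simp add: outer_unit_normal_def)
  then have u_mem: "c * \<rho> u < \<rho>' u" using aleksandrov_radial[OF K K' u(1) c _ v(2)] by blast
  define U where "U = {u \<in> sphere 0 1. c * \<rho> u < \<rho>' u}"
  have "openin (top_of_set (sphere 0 1)) (sphere 0 1 \<inter> (\<lambda>u. \<rho>' u - c * \<rho> u) -` {0<..})"
    by (intro continuous_openin_preimage_gen continuous_intros continuous_on_radial_fun K K' open_greaterThan)
  also have "sphere 0 1 \<inter> (\<lambda>u. \<rho>' u - c * \<rho> u) -` {0<..} = U" by (auto simp: U_def)
  finally obtain V where V: "open V" "U = V \<inter> sphere 0 1" by (auto simp: openin_open)
  have "U \<in> sets sphere_space"
    using V by (auto simp: sets_sphere_space_iff intro!: sets_borel_sphere_measure)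
  moreover have "AE u in sphere_space. u \<notin> U"
    using null AE_radial_gauss_map_normal[OF K]
  proof eventually_elim
    case (elim u)
    then show ?case using aleksandrov_normal[OF K K', of u "\<alpha> u" c] by (auto simp: U_def reach_def)
  qed
  ultimately have "emeasure sphere_space U = 0"
    using complete_measure.null_sets_iff_AE[OF complete_sphere_space, of U] sets.sets_into_space
    by (force simp: null_sets_def)
  then have "hausdorff_outer (DIM(real ^ 'n) - 1) (V \<inter> sphere 0 1) = 0"
    using emeasure_sphere_space[OF \<open>U \<in> sets sphere_space\<close>] V by simp
  moreover have "V \<inter> sphere 0 1 \<noteq> {}" using u_mem u(1) V(2) by (auto simp: U_def)
  ultimately show False using hausdorff_outer_open_sphere_pos[OF V(1)] by blast
qed

lemma AE_dens_pos: "AE u in sphere_space. dens u > 0"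
  using AE_radial_gauss_map_normal[OF K]
  by eventually_elim
     (simp add: curvature_density_def g_pos psi_pos h_pos radial_fun_mem_upper(1)[OF K])

text \<open>
  The common contradiction. The measure on normals is the same for both bodies, so are its
  integrals of \<open>\<kappa>\<close> over reach c. Read in the directions u, the integral for K' is
  over a smaller set of directions, and its integrand lies below w there, while that for
  K lies above w. Equality is possible only if both integrals vanish, so that K has almost
  no normals in reach c, which \<open>reach_not_null\<close> excludes.
\<close>
lemma no_separating_weight:
  assumes c: "c > 0" and ne: "reach c \<noteq> {}"
    and \<kappa>: "\<kappa> \<in> borel_measurable borel" "\<And>v. v \<in> reach c \<Longrightarrow> \<kappa> v > 0"
    and w: "w \<in> borel_measurable sphere_space"
    and below: "AE u in sphere_space. \<alpha>' u \<in> reach c \<longrightarrow> ennreal (dens' u) * \<kappa> (\<alpha>' u) < w u"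
    and above: "AE u in sphere_space. \<alpha> u \<in> reach c \<longrightarrow> w u \<le> ennreal (dens u) * \<kappa> (\<alpha> u)"
    and fin: "(\<integral>\<^sup>+u. ennreal (dens u) * (\<kappa> (\<alpha> u) * indicator (reach c) (\<alpha> u)) \<partial>sphere_space) < \<infinity>"
  shows False
proof -
  note [measurable] = measurable_radial_gauss_map[OF K] measurable_radial_gauss_map[OF K']
    borel_measurable_integrable[OF int_dens(1)] borel_measurable_integrable[OF int_dens(2)] \<kappa>(1) w borel_reach
  let ?I = "\<integral>\<^sup>+u. ennreal (dens u) * (\<kappa> (\<alpha> u) * indicator (reach c) (\<alpha> u)) \<partial>sphere_space"
  let ?f = "\<lambda>u. ennreal (dens' u) * (\<kappa> (\<alpha>' u) * indicator (reach c) (\<alpha>' u))"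
  let ?w = "\<lambda>u. w u * indicator (reach c) (\<alpha>' u)"
  have \<kappa>c: "(\<lambda>v. \<kappa> v * indicator (reach c) v) \<in> borel_measurable borel" by measurable
  have same: "?I = integral\<^sup>N sphere_space ?f"
    using nn_integral_normal_measure[OF K borel_measurable_integrable[OF int_dens(1)] \<kappa>c]
      nn_integral_normal_measure[OF K' borel_measurable_integrable[OF int_dens(2)] \<kappa>c] same_measure by simp
  have fw: "AE u in sphere_space. ?f u \<le> ?w u"
    using below by eventually_elim (auto simp: indicator_def)
  have "integral\<^sup>N sphere_space ?w \<le> ?I"
  proof (rule nn_integral_mono_AE)
    show "AE u in sphere_space. ?w u \<le> ennreal (dens u) * (\<kappa> (\<alpha> u) * indicator (reach c) (\<alpha> u))"
      using above AE_reach_inclusion[OF c] by eventually_elim (auto simp: indicator_def)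
  qed
  then have "\<not> integral\<^sup>N sphere_space ?f < integral\<^sup>N sphere_space ?w" using same by simp
  moreover have "integral\<^sup>N sphere_space ?f \<noteq> \<infinity>" using fin same by simp
  ultimately have "AE u in sphere_space. ?w u \<le> ?f u"
    using nn_integral_less[OF _ _ _ fw] by (auto simp del: infinity_ennreal_def)
  then have empty: "AE u in sphere_space. \<alpha>' u \<notin> reach c"
    using below by eventually_elim (auto simp: indicator_def not_le split: if_splits)
  have "integral\<^sup>N sphere_space ?f = (\<integral>\<^sup>+u. 0 \<partial>(sphere_space :: (real ^ 'n) measure))"
    using empty by (intro nn_integral_cong_AE) (auto elim!: eventually_mono)
  then have "?I = 0" using same by simp
  then have "AE u in sphere_space. ennreal (dens u) * (\<kappa> (\<alpha> u) * indicator (reach c) (\<alpha> u)) = 0"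
    by (subst (asm) nn_integral_0_iff_AE) measurable
  then have "AE u in sphere_space. \<alpha> u \<notin> reach c"
    using AE_dens_pos
  proof eventually_elim
    case (elim u)
    then show ?case using \<kappa>(2)[of "\<alpha> u"] by (auto simp: indicator_def split: if_splits)
  qed
  then show False using reach_not_null[OF c ne] by blast
qed

text \<open>
  In almost all directions with a normal in reach c the boundary point of K' is l times that of
  K, with the same normal; there the density of K itself is the separating weight.
\<close>
lemma not_polytope: "\<not> polytope K'"
proof
  assume "polytope K'"
  then obtain W where W: "finite W" "\<And>u. norm u = 1 \<Longrightarrow> \<exists>v\<in>W. outer_unit_normal K' (\<rho>' u *\<^sub>R u) v"
    using polytope_finite_normals[OF K'] by metis
  obtain l v\<^sub>0 where l: "l > 1" "norm v\<^sub>0 = 1" "h' v\<^sub>0 = l * h v\<^sub>0"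
    "\<And>w. norm w = 1 \<Longrightarrow> h' w \<le> l * h w" "\<And>u. norm u = 1 \<Longrightarrow> \<rho>' u \<le> l * \<rho> u"
    using maximal_dilation by metis
  \<comment> \<open>As W is finite, c can be chosen so that the normals of K' in reach c are those of maximal ratio.\<close>
  define c where "c = Max (insert (l / 2) ((\<lambda>v. h' v / h v) ` W \<inter> {..<l}))"
  have fin: "finite (insert (l / 2) ((\<lambda>v. h' v / h v) ` W \<inter> {..<l}))" using W(1) by simp
  have "c < l" unfolding c_def using fin l(1) by (subst Max_less_iff) auto
  have "l / 2 \<le> c" unfolding c_def using fin by (intro Max_ge) auto
  then have "c > 0" using l(1) by simp
  have contact: "h' v = l * h v" if "v \<in> W" "v \<in> reach c" for v
  proof (rule ccontr)
    assume "h' v \<noteq> l * h v"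
    moreover have "norm v = 1" "c * h v < h' v" using that by (auto simp: reach_def)
    ultimately have "h' v < l * h v" "h v > 0" using l(4)[of v] h_pos(1) by auto
    then have "h' v / h v < l" by (simp add: divide_less_eq)
    then have "h' v / h v \<le> c" unfolding c_def using fin \<open>v \<in> W\<close> by (intro Max_ge) auto
    then show False using \<open>c * h v < h' v\<close> \<open>h v > 0\<close> by (simp add: divide_le_eq)
  qed
  show False
  proof (rule no_separating_weight[where c = c and \<kappa> = "\<lambda>_. 1" and w = "\<lambda>u. ennreal (dens u)"])
    show "reach c \<noteq> {}" using l(2,3) \<open>c < l\<close> h_pos(1)[OF l(2)] by (auto simp: reach_def)
    show "(\<lambda>u. ennreal (dens u)) \<in> borel_measurable sphere_space"
      using borel_measurable_integrable[OF int_dens(1)] by measurable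
    show "AE u in sphere_space. \<alpha>' u \<in> reach c \<longrightarrow> ennreal (dens' u) * 1 < ennreal (dens u)"
      using AE_radial_gauss_map[OF K] AE_radial_gauss_map[OF K'] AE_dens_pos
    proof eventually_elim
      case (elim u)
      then have u: "norm u = 1" and N: "\<And>v. outer_unit_normal K (\<rho> u *\<^sub>R u) v \<longleftrightarrow> v = \<alpha> u"
        and N': "\<And>v. outer_unit_normal K' (\<rho>' u *\<^sub>R u) v \<longleftrightarrow> v = \<alpha>' u" by auto
      show ?case
      proof
        assume E: "\<alpha>' u \<in> reach c"
        have n': "norm (\<alpha>' u) = 1" "\<alpha>' u \<bullet> u > 0" "\<rho>' u * (\<alpha>' u \<bullet> u) = h' (\<alpha>' u)"
          using outer_unit_normalD[OF K' u] N' by auto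
        have "\<alpha>' u \<in> W" using W(2)[OF u] N' by auto
        then have h'l: "h' (\<alpha>' u) = l * h (\<alpha>' u)" using contact E by blast
        have le: "\<rho> u * (\<alpha>' u \<bullet> u) \<le> h (\<alpha>' u)"
          using inner_le_support_fun[OF convex_body_o_D(1)[OF K] radial_fun_mem_upper(2)[OF K u], of "\<alpha>' u"] by simp
        then have "l * (\<rho> u * (\<alpha>' u \<bullet> u)) \<le> \<rho>' u * (\<alpha>' u \<bullet> u)"
          unfolding n'(3) h'l using l(1) by simp
        then have "(l * \<rho> u) * (\<alpha>' u \<bullet> u) \<le> \<rho>' u * (\<alpha>' u \<bullet> u)" by (simp add: mult.assoc)
        then have "l * \<rho> u \<le> \<rho>' u" using n'(2) by (simp add: mult_le_cancel_right)
        then have rho: "\<rho>' u = l * \<rho> u" using l(5)[OF u] by simp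
        then have "\<rho> u * (\<alpha>' u \<bullet> u) = h (\<alpha>' u)" using n'(3) h'l l(1) by simp
        then have "outer_unit_normal K (\<rho> u *\<^sub>R u) (\<alpha>' u)" using n'(1) by (simp add: outer_unit_normal_def)
        then have \<alpha>: "\<alpha>' u = \<alpha> u" using N by simp
        have "dens' u < dens u"
          unfolding curvature_density_def rho \<alpha> h'l[unfolded \<alpha>]
          by (rule dilation) (use l(1) u n'(1) h_pos(1) \<alpha> radial_fun_mem_upper(1)[OF K u] in auto)
        then show "ennreal (dens' u) * 1 < ennreal (dens u)"
          using elim by (simp add: ennreal_less_iff ennreal_lessI)
      qed
    qed
    have "(\<integral>\<^sup>+u. ennreal (dens u) * (1 * indicator (reach c) (\<alpha> u)) \<partial>sphere_space)
        \<le> (\<integral>\<^sup>+u. ennreal (norm (dens u)) \<partial>sphere_space)"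
      by (intro nn_integral_mono) (auto simp: indicator_def intro: ennreal_leI)
    also have "\<dots> < \<infinity>" using int_dens(1) by (simp add: integrable_iff_bounded)
    finally show "(\<integral>\<^sup>+u. ennreal (dens u) * (1 * indicator (reach c) (\<alpha> u)) \<partial>sphere_space) < \<infinity>" .
  qed (use \<open>c > 0\<close> in auto)
qed

text \<open>
  With unique support points, the density of K is a continuous function \<open>\<Phi>\<close> of the normal.
  Near the normals of maximal ratio the support points of K' are close to l times those of
  K, so the density of K' lies below \<open>\<Phi>\<close> there; \<open>1 / \<Phi>\<close> is the separating weight.
\<close>
lemma not_unique_support_points:
  assumes g_cont: "continuous_on ({0<..} \<times> sphere 0 1) (\<lambda>(t, u). g t u)"
    and unique: "\<And>v x y. v \<noteq> 0 \<Longrightarrow> x \<in> K \<Longrightarrow> v \<bullet> x = h v \<Longrightarrow> y \<in> K \<Longrightarrow> v \<bullet> y = h v \<Longrightarrow> x = y"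
  shows False
proof -
  obtain l v\<^sub>0 where l: "l > 1" "norm v\<^sub>0 = 1" "h' v\<^sub>0 = l * h v\<^sub>0"
    "\<And>w. norm w = 1 \<Longrightarrow> h' w \<le> l * h w" "\<And>u. norm u = 1 \<Longrightarrow> \<rho>' u \<le> l * \<rho> u"
    using maximal_dilation by metis
  have "\<exists>x. x \<in> K \<and> v \<bullet> x = h v" for v
    using support_fun_attained[OF convex_body_o_D(1,5)[OF K]] by blast
  then obtain X where X: "\<And>v. X v \<in> K" "\<And>v. v \<bullet> X v = h v"
    by metis
  have X_eq: "X v = x" if "norm v = 1" "x \<in> K" "v \<bullet> x = h v" for v x
    using unique[of v "X v" x] that X by force
  have X_cont: "continuous_on (sphere 0 1) X"
  proof (rule continuous_from_closed_graph)
    show "compact K" by (rule convex_body_o_D(1)[OF K])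
    show "X \<in> sphere 0 1 \<rightarrow> K" using X by auto
    have "(\<lambda>v. (v, X v)) ` sphere 0 1 = {z \<in> sphere 0 1 \<times> K. fst z \<bullet> snd z - h (fst z) = 0}"
      using X X_eq by (auto simp: image_iff)
    moreover have "closed {z \<in> sphere 0 1 \<times> K. fst z \<bullet> snd z - h (fst z) = 0}"
      by (intro continuous_closed_preimage_constant continuous_intros closed_Times closed_sphere
          convex_body_o_D(6)[OF K] continuous_on_compose2[OF cont_h(1)[of UNIV]]) auto
    ultimately show "closed ((\<lambda>v. (v, X v)) ` sphere 0 1)" by simp
  qed
  define F where "F x s = norm x * g (norm x) ((1 / norm x) *\<^sub>R x) / \<psi> s" for x s
  have F_cont: "continuous_on A (\<lambda>z. F (a z) (b z))"
    if "continuous_on A a" "continuous_on A b" "\<And>z. z \<in> A \<Longrightarrow> a z \<noteq> 0" "\<And>z. z \<in> A \<Longrightarrow> b z > 0"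
    for A :: "'z::topological_space set" and a b
  proof -
    have "continuous_on A (\<lambda>z. (\<lambda>(t, u). g t u) (norm (a z), (1 / norm (a z)) *\<^sub>R a z))"
      using that by (intro continuous_on_compose2[OF g_cont] continuous_intros) auto
    moreover have "continuous_on A (\<lambda>z. \<psi> (b z))"
      using that by (intro continuous_on_compose2[OF psi_cont]) auto
    moreover have "\<psi> (b z) \<noteq> 0" if "z \<in> A" for z
      using psi_pos[OF \<open>\<And>z. z \<in> A \<Longrightarrow> b z > 0\<close>[OF that]] by simp
    ultimately show ?thesis unfolding F_def using that by (auto intro!: continuous_intros)
  qed
  define \<Phi> where "\<Phi> v = F (X v) (h v)" for v
  have X_ne: "X v \<noteq> 0" if "norm v = 1" for v
  proof -
    have "v \<noteq> 0" using that by auto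
    then show ?thesis by (rule radial_fun_eq_if_normal(1)[OF K X(1) _ X(2)])
  qed
  have \<Phi>_cont: "continuous_on (sphere 0 1) \<Phi>"
    unfolding \<Phi>_def using X_ne h_pos(1) by (intro F_cont X_cont cont_h) auto
  have \<Phi>_pos: "\<Phi> v > 0" if "norm v = 1" for v
    using X_ne[OF that] h_pos(1)[OF that] by (simp add: \<Phi>_def F_def g_pos psi_pos)
  \<comment> \<open>At a normal of maximal ratio the support points are proportional.\<close>
  have contact: "F x (h' v) < \<Phi> v" if v: "norm v = 1" "h' v = l * h v" and x: "x \<in> K'" "v \<bullet> x = h' v" for v x
  proof -
    have "v \<noteq> 0" using v by auto
    define u where "u = (1 / norm x) *\<^sub>R x"
    note xu = radial_fun_eq_if_normal[OF K' x(1) \<open>v \<noteq> 0\<close> x(2), folded u_def]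
    have u: "norm u = 1" "x = norm x *\<^sub>R u" using xu by (auto simp: u_def)
    note rad = radial_fun_mem_upper[OF K u(1)]
    have le: "norm x \<le> l * \<rho> u" using l(5)[OF u(1)] xu(2) by simp
    have eq: "norm x * (v \<bullet> u) = l * h v" using x(2) v(2) u(2) by (metis inner_scaleR_right)
    moreover have "l * h v > 0" using h_pos(1)[OF v(1)] l(1) by simp
    ultimately have "v \<bullet> u > 0" using xu(1) by (metis norm_ge_zero not_less zero_less_mult_pos zero_less_norm_iff)
    have "v \<bullet> (\<rho> u *\<^sub>R u) \<le> h v"
      by (rule inner_le_support_fun[OF convex_body_o_D(1)[OF K] rad(2)])
    then have "l * (\<rho> u * (v \<bullet> u)) \<le> norm x * (v \<bullet> u)" using eq l(1) by simp
    then have "l * \<rho> u \<le> norm x" using \<open>v \<bullet> u > 0\<close> by (simp add: mult.assoc[symmetric])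
    with le have nx: "norm x = l * \<rho> u" by simp
    then have "v \<bullet> (\<rho> u *\<^sub>R u) = h v" using eq l(1) by simp
    then have Xv: "X v = \<rho> u *\<^sub>R u" by (rule X_eq[OF v(1) rad(2)])
    have "norm (X v) = \<rho> u" "(1 / norm (X v)) *\<^sub>R X v = u" using Xv rad(1) u(1) by simp_all
    then have "\<Phi> v = \<rho> u * g (\<rho> u) u / \<psi> (h v)" by (simp add: \<Phi>_def F_def)
    moreover have "F x (h' v) = norm x * g (norm x) u / \<psi> (h' v)"
      by (simp only: F_def u_def)
    then have "F x (h' v) = l * \<rho> u * g (l * \<rho> u) u / \<psi> (l * h v)"
      by (simp only: nx v(2))
    ultimately show ?thesis using dilation[OF l(1) rad(1) h_pos(1)[OF v(1)] u(1)] by simp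
  qed
  \<comment> \<open>By compactness the strict inequality persists for ratios close to the maximal one.\<close>
  obtain c where c: "0 < c" "c < l" and below: "\<And>v x. norm v = 1 \<Longrightarrow> c * h v < h' v \<Longrightarrow> x \<in> K' \<Longrightarrow>
      v \<bullet> x = h' v \<Longrightarrow> F x (h' v) < \<Phi> v"
  proof -
    define C where "C = {z \<in> sphere 0 1 \<times> K'. fst z \<bullet> snd z - h' (fst z) = 0}"
    define Z where "Z = {z \<in> C. \<Phi> (fst z) \<le> F (snd z) (h' (fst z))}"
    have "closed C"
      unfolding C_def
      by (intro continuous_closed_preimage_constant continuous_intros closed_Times closed_sphere
          convex_body_o_D(6)[OF K'] continuous_on_compose2[OF cont_h(2)[of UNIV]]) auto
    have C_ne: "snd z \<noteq> 0" if "z \<in> C" for z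
    proof (rule radial_fun_eq_if_normal(1)[OF K'])
      show "snd z \<in> K'" "fst z \<noteq> 0" "fst z \<bullet> snd z = h' (fst z)"
        using that by (auto simp: C_def)
    qed
    have "closed Z"
      unfolding Z_def
    proof (rule continuous_on_closed_Collect_le[OF _ _ \<open>closed C\<close>])
      show "continuous_on C (\<lambda>z. \<Phi> (fst z))"
        by (rule continuous_on_compose2[OF \<Phi>_cont]) (auto intro!: continuous_intros simp: C_def)
      show "continuous_on C (\<lambda>z. F (snd z) (h' (fst z)))"
        by (intro F_cont continuous_on_compose2[OF cont_h(2)[of UNIV]])
           (auto intro!: continuous_intros C_ne h_pos(2) simp: C_def)
    qed
    moreover have "bounded Z"
      by (rule bounded_subset[of "sphere 0 1 \<times> K'"])
         (auto simp: Z_def C_def intro!: bounded_Times compact_imp_bounded[OF convex_body_o_D(1)[OF K']])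
    ultimately have "compact Z" by (simp add: compact_eq_bounded_closed)
    define c where "c = (if Z = {} then l / 2 else max (l / 2) (Sup ((\<lambda>z. h' (fst z) / h (fst z)) ` Z)))"
    have "c < l \<and> (\<forall>z\<in>Z. h' (fst z) / h (fst z) \<le> c)"
    proof (cases "Z = {}")
      case False
      have "continuous_on Z (\<lambda>z. h' (fst z) / h (fst z))"
        using h_pos(1)
        by (intro continuous_intros continuous_on_compose2[OF cont_h(1)[of UNIV]] continuous_on_compose2[OF cont_h(2)[of UNIV]])
           (force simp: Z_def C_def)+
      then obtain z where z: "z \<in> Z" "\<And>y. y \<in> Z \<Longrightarrow> h' (fst y) / h (fst y) \<le> h' (fst z) / h (fst z)"
        using continuous_attains_sup[OF \<open>compact Z\<close> False] by blast
      then have "Sup ((\<lambda>z. h' (fst z) / h (fst z)) ` Z) = h' (fst z) / h (fst z)"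
        by (intro cSup_eq_maximum) auto
      then have c_eq: "c = max (l / 2) (h' (fst z) / h (fst z))" using False by (simp add: c_def)
      have nz: "norm (fst z) = 1" "snd z \<in> K'" "fst z \<bullet> snd z = h' (fst z)" "\<Phi> (fst z) \<le> F (snd z) (h' (fst z))"
        using z(1) by (auto simp: Z_def C_def)
      have "h' (fst z) \<noteq> l * h (fst z)" using contact[OF nz(1) _ nz(2,3)] nz(4) by linarith
      then have "h' (fst z) < l * h (fst z)" using l(4)[OF nz(1)] by linarith
      then have "h' (fst z) / h (fst z) < l" using h_pos(1)[OF nz(1)] by (simp add: divide_less_eq)
      then show ?thesis using z(2) l(1) unfolding c_eq by force
    qed (use l(1) in \<open>simp add: c_def\<close>)
    note c = this
    show ?thesis
    proof
      show "0 < c" using l(1) by (auto simp: c_def)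
      show "c < l" using c by blast
      fix v x assume v: "norm v = 1" "c * h v < h' v" and x: "x \<in> K'" "v \<bullet> x = h' v"
      show "F x (h' v) < \<Phi> v"
      proof (rule ccontr)
        assume "\<not> F x (h' v) < \<Phi> v"
        then have "(v, x) \<in> Z" using v x by (simp add: Z_def C_def)
        then have "h' v / h v \<le> c" using c by force
        then show False using v(2) h_pos(1)[OF v(1)] by (simp add: divide_le_eq)
      qed
    qed
  qed
  have dens_F: "curvature_density g \<psi> L u = F (radial_fun L u *\<^sub>R u) (support_fun L (radial_gauss_map L u))"
    if "convex_body_o L" "norm u = 1" for L u
    using radial_fun_mem_upper(1)[OF that] that(2) by (simp add: curvature_density_def F_def)
  have inv_cont: "continuous_on (sphere 0 1) (\<lambda>v. 1 / \<Phi> v)"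
    using \<Phi>_pos by (intro continuous_intros \<Phi>_cont) force
  define \<kappa> where "\<kappa> v = ennreal (indicator (sphere 0 1) v *\<^sub>R (1 / \<Phi> v))" for v
  have dens_\<Phi>: "AE u in sphere_space. norm (\<alpha> u) = 1 \<and> dens u = \<Phi> (\<alpha> u)"
    using AE_radial_gauss_map_normal[OF K]
  proof eventually_elim
    case (elim u)
    then have u: "norm u = 1" and N: "outer_unit_normal K (\<rho> u *\<^sub>R u) (\<alpha> u)" by auto
    have "X (\<alpha> u) = \<rho> u *\<^sub>R u"
      using N radial_fun_mem_upper(2)[OF K u] by (intro X_eq) (auto simp: outer_unit_normal_def)
    then show ?case using elim dens_F[OF K u] by (simp add: \<Phi>_def)
  qed
  show False
  proof (rule no_separating_weight[where c = c and \<kappa> = \<kappa> and w = "\<lambda>u. 1"])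
    show "reach c \<noteq> {}" using l(2,3) c(2) h_pos(1)[OF l(2)] by (auto simp: reach_def)
    have "(\<lambda>v. indicator (sphere 0 1) v *\<^sub>R (1 / \<Phi> v)) \<in> borel_measurable borel"
      by (rule borel_measurable_continuous_on_indicator[OF _ inv_cont]) auto
    then show "\<kappa> \<in> borel_measurable borel" unfolding \<kappa>_def by measurable
    show "\<kappa> v > 0" if "v \<in> reach c" for v using that \<Phi>_pos[of v] by (simp add: \<kappa>_def reach_def)
    show "AE u in sphere_space. \<alpha>' u \<in> reach c \<longrightarrow> ennreal (dens' u) * \<kappa> (\<alpha>' u) < 1"
      using AE_radial_gauss_map_normal[OF K']
    proof eventually_elim
      case (elim u)
      show ?case
      proof
        assume E: "\<alpha>' u \<in> reach c"
        have u: "norm u = 1" and v: "norm (\<alpha>' u) = 1" "c * h (\<alpha>' u) < h' (\<alpha>' u)"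
          using elim E by (auto simp: reach_def)
        have "dens' u < \<Phi> (\<alpha>' u)"
          unfolding dens_F[OF K' u]
          using elim by (intro below[OF v radial_fun_mem_upper(2)[OF K' u]]) (simp add: outer_unit_normal_def)
        moreover have "dens' u \<ge> 0"
          unfolding curvature_density_def
          using g_pos[OF radial_fun_mem_upper(1)[OF K' u] u] psi_pos[OF h_pos(2)[OF v(1)]] radial_fun_mem_upper(1)[OF K' u] by simp
        ultimately have "dens' u * (1 / \<Phi> (\<alpha>' u)) < 1" "0 \<le> dens' u * (1 / \<Phi> (\<alpha>' u))"
          using \<Phi>_pos[OF v(1)] by (auto simp: divide_less_eq)
        then have "ennreal (dens' u * (1 / \<Phi> (\<alpha>' u))) < 1" by (simp add: ennreal_less_one_iff)
        then show "ennreal (dens' u) * \<kappa> (\<alpha>' u) < 1"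
          using v(1) \<Phi>_pos[OF v(1)] \<open>dens' u \<ge> 0\<close> by (simp add: \<kappa>_def ennreal_mult[symmetric])
      qed
    qed
    show "AE u in sphere_space. \<alpha> u \<in> reach c \<longrightarrow> 1 \<le> ennreal (dens u) * \<kappa> (\<alpha> u)"
      using dens_\<Phi>
    proof eventually_elim
      case (elim u)
      then show ?case using \<Phi>_pos[of "\<alpha> u"] by (simp add: \<kappa>_def ennreal_mult[symmetric])
    qed
    obtain B where B: "\<And>v. norm v = 1 \<Longrightarrow> \<bar>1 / \<Phi> v\<bar> \<le> B"
      using continuous_on_sphere_bounded[OF inv_cont] by blast
    have "(\<integral>\<^sup>+u. ennreal (dens u) * (\<kappa> (\<alpha> u) * indicator (reach c) (\<alpha> u)) \<partial>sphere_space)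
        \<le> (\<integral>\<^sup>+u. ennreal (norm (dens u)) * ennreal B \<partial>sphere_space)"
    proof (rule nn_integral_mono)
      fix u :: "real ^ 'n"
      have "\<kappa> (\<alpha> u) * indicator (reach c) (\<alpha> u) \<le> ennreal B"
        using order_trans[OF abs_ge_self B[of "\<alpha> u"]] by (auto simp: \<kappa>_def indicator_def reach_def intro!: ennreal_leI)
      then show "ennreal (dens u) * (\<kappa> (\<alpha> u) * indicator (reach c) (\<alpha> u)) \<le> ennreal (norm (dens u)) * ennreal B"
        by (intro mult_mono ennreal_leI) auto
    qed
    also have "\<dots> = (\<integral>\<^sup>+u. ennreal (norm (dens u)) \<partial>sphere_space) * ennreal B"
      using borel_measurable_integrable[OF int_dens(1)] by (intro nn_integral_multc) measurable
    also have "\<dots> < \<infinity>" using int_dens(1) by (simp add: integrable_iff_bounded ennreal_mult_less_top)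
    finally show "(\<integral>\<^sup>+u. ennreal (dens u) * (\<kappa> (\<alpha> u) * indicator (reach c) (\<alpha> u)) \<partial>sphere_space) < \<infinity>" .
  qed (use c(1) in auto)
qed

end

section \<open>Uniqueness\<close>

text \<open>
  Both conditions of the theorem take this form with \<open>g = \<bar>G\<^sub>t\<bar>\<close> and sg the sign of \<open>G\<^sub>t\<close>.
\<close>
lemma support_fun_le_if_same_curvature_measure:
  fixes G g :: "real \<Rightarrow> real ^ 'n \<Rightarrow> real" and L L' :: "(real ^ 'n) set"
  assumes G_cont: "continuous_on ({0<..} \<times> sphere 0 1) (\<lambda>(t, u). G t u)"
    and psi_pos: "\<And>s. s > 0 \<Longrightarrow> \<psi> s > 0" and psi_cont: "continuous_on {0<..} \<psi>"
    and G_diff: "\<And>t u. t > 0 \<Longrightarrow> norm u = 1 \<Longrightarrow> (\<lambda>s. G s u) differentiable (at t)"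
    and sg: "\<And>t u. partial_t G t u = sg * g t u" "sg = 1 \<or> sg = -1"
    and g_pos: "\<And>t u. t > 0 \<Longrightarrow> norm u = 1 \<Longrightarrow> g t u > 0"
    and dilation: "\<And>l t s u. l > 1 \<Longrightarrow> t > 0 \<Longrightarrow> s > 0 \<Longrightarrow> norm u = 1 \<Longrightarrow>
      (l * t) * g (l * t) u / \<psi> (l * s) < t * g t u / \<psi> s"
    and L: "convex_body_o L" and L': "convex_body_o L'"
    and shape: "(polytope L \<and> polytope L') \<or> (C2_support L \<and> C2_support L')"
    and defined: "dual_curvature_defined G L" "dual_curvature_defined G L'"
    and eq: "\<And>E. E \<in> sets borel \<Longrightarrow> E \<subseteq> sphere 0 1 \<Longrightarrow>
      dual_curvature_measure G \<psi> L E = dual_curvature_measure G \<psi> L' E"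
    and v: "norm v = 1"
  shows "support_fun L' v \<le> support_fun L v"
proof (rule ccontr)
  assume "\<not> support_fun L' v \<le> support_fun L v"
  then have larger: "\<exists>v. norm v = 1 \<and> support_fun L v < support_fun L' v" using v by force
  have g_eq: "g t u = sg * partial_t G t u" for t u using sg by (auto simp: sg(1))
  have int: "integrable sphere_space (curvature_density g \<psi> M)"
    if "convex_body_o M" "dual_curvature_defined G M" for M
  proof (rule integrable_curvature_density[OF that(1) psi_pos psi_cont])
    have "integrable sphere_space (\<lambda>u. partial_t G (radial_fun M u) u)"
      using that(2) unfolding dual_curvature_defined_def set_integrable_def sphere_space_def
      by (subst integrable_restrict_space[OF sphere_in_sets])
    then show "integrable sphere_space (\<lambda>u. g (radial_fun M u) u)"
      unfolding g_eq by (rule integrable_mult_right)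
  qed
  have nonneg: "AE u in sphere_space. 0 \<le> curvature_density g \<psi> M u" if M: "convex_body_o M" for M
    using AE_radial_gauss_map_normal[OF M]
  proof eventually_elim
    case (elim u)
    then have "radial_gauss_map M u \<noteq> 0" by auto
    then have "\<psi> (support_fun M (radial_gauss_map M u)) > 0" by (intro psi_pos support_fun_pos[OF M])
    then show ?case
      using elim radial_fun_mem_upper(1)[OF M, of u] g_pos[of "radial_fun M u" u]
      by (simp add: curvature_density_def)
  qed
  have same: "normal_measure g \<psi> L = normal_measure g \<psi> L'"
    by (rule normal_measure_eqI[OF L L' int[OF L defined(1)] int[OF L' defined(2)] nonneg[OF L] nonneg[OF L'] sg(1) _ eq])
       (use sg(2) in auto)
  interpret orlicz_pair g \<psi> L L'
    by unfold_locales
       (use g_pos psi_pos psi_cont dilation L L' int[OF L defined(1)] int[OF L' defined(2)] same larger in auto)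
  show False
  proof (cases "polytope L'")
    case True
    then show False using not_polytope by blast
  next
    case False
    then have C2: "C2_support L" using shape by blast
    show False
    proof (rule not_unique_support_points)
      show "continuous_on ({0<..} \<times> sphere 0 1) (\<lambda>(t, u). g t u)"
      proof (rule partial_derivative_jointly_continuous[where G = "\<lambda>t u. sg * G t u" and q = "\<lambda>t. \<psi> t / t"])
        show "continuous_on ({0<..} \<times> sphere 0 1) (\<lambda>(t, u). sg * G t u)"
          using continuous_on_mult_left[OF G_cont, of sg] by (simp add: case_prod_beta)
        show "((\<lambda>s. sg * G s u) has_real_derivative g t u) (at t)" if "t > 0" "u \<in> sphere 0 1" for t u
          using DERIV_cmult[of "\<lambda>s. G s u" "partial_t G t u" t UNIV sg] G_diff[of t u] that
          unfolding g_eq partial_t_def by (simp add: DERIV_deriv_iff_real_differentiable)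
        show "continuous_on {0<..} (\<lambda>t. \<psi> t / t)"
          by (intro continuous_intros psi_cont) auto
        show "\<psi> t / t > 0" if "t > 0" for t using that psi_pos by simp
        show "g t u / (\<psi> t / t) \<le> g s u / (\<psi> s / s)" if "0 < s" "s < t" "u \<in> sphere 0 1" for s t u
          using dilation[of "t / s" s s u] that by (simp add: mult.commute)
      qed
      show "x = y" if "w \<noteq> 0" "x \<in> L" "w \<bullet> x = support_fun L w" "y \<in> L" "w \<bullet> y = support_fun L w" for w x y
        by (rule C2_support_unique_maximiser[OF L C2 that])
    qed
  qed
qed

theorem theorem6p5:
  fixes G :: "real \<Rightarrow> real ^ 'n \<Rightarrow> real"
    and \<psi> :: "real \<Rightarrow> real"
    and K K' :: "(real ^ 'n) set"
  assumes G_pos: "\<forall>t>0. \<forall>u\<in>sphere 0 1. G t u > 0"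
    and G_cont: "continuous_on ({0<..} \<times> sphere 0 1) (\<lambda>(t, u). G t u)"
    and psi_pos: "\<forall>s>0. \<psi> s > 0"
    and psi_cont: "continuous_on {0<..} \<psi>"
    and G_diff: "\<forall>t>0. \<forall>u\<in>sphere 0 1. (\<lambda>s. G s u) differentiable (at t)"
    and cond:
      "((\<forall>t>0. \<forall>u\<in>sphere 0 1. partial_t G t u > 0) \<and>
        (\<forall>l>0. \<forall>s>0. \<forall>t>0. \<forall>u\<in>sphere 0 1.
           partial_t G t u / \<psi> s \<ge> l * partial_t G (l * t) u / \<psi> (l * s) \<longrightarrow> l \<ge> 1))
       \<or>
       ((\<forall>t>0. \<forall>u\<in>sphere 0 1. partial_t G t u < 0) \<and>
        (\<forall>l>0. \<forall>s>0. \<forall>t>0. \<forall>u\<in>sphere 0 1.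
           partial_t G t u / \<psi> s \<le> l * partial_t G (l * t) u / \<psi> (l * s) \<longrightarrow> l \<ge> 1))"
    and K: "convex_body_o K"
    and K': "convex_body_o K'"
    and polytopes_or_C2: "(polytope K \<and> polytope K') \<or> (C2_support K \<and> C2_support K')"
    and K_defined: "dual_curvature_defined G K"
    and K'_defined: "dual_curvature_defined G K'"
    and eq: "\<forall>E\<in>sets borel. E \<subseteq> sphere 0 1 \<longrightarrow>
               dual_curvature_measure G \<psi> K E = dual_curvature_measure G \<psi> K' E"
  shows "K = K'"
proof -
  obtain sg :: real where sg: "sg = 1 \<or> sg = -1"
    and pos: "\<And>t u. t > 0 \<Longrightarrow> norm u = 1 \<Longrightarrow> sg * partial_t G t u > 0"
    and cond': "\<And>l s t u. l > 0 \<Longrightarrow> s > 0 \<Longrightarrow> t > 0 \<Longrightarrow> norm u = 1 \<Longrightarrow>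
      l * (sg * partial_t G (l * t) u) / \<psi> (l * s) \<le> sg * partial_t G t u / \<psi> s \<Longrightarrow> l \<ge> 1"
    using cond
  proof
    assume a: "(\<forall>t>0. \<forall>u\<in>sphere 0 1. partial_t G t u > 0) \<and>
        (\<forall>l>0. \<forall>s>0. \<forall>t>0. \<forall>u\<in>sphere 0 1.
           partial_t G t u / \<psi> s \<ge> l * partial_t G (l * t) u / \<psi> (l * s) \<longrightarrow> l \<ge> 1)"
    show ?thesis
    proof (rule that[of 1])
      show "1 \<le> l" if "l > 0" "s > 0" "t > 0" "norm u = 1"
        "l * (1 * partial_t G (l * t) u) / \<psi> (l * s) \<le> 1 * partial_t G t u / \<psi> s" for l s t u
        using conjunct2[OF a, rule_format, of l s t u] that by simp
    qed (use a in auto)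
  next
    assume b: "(\<forall>t>0. \<forall>u\<in>sphere 0 1. partial_t G t u < 0) \<and>
        (\<forall>l>0. \<forall>s>0. \<forall>t>0. \<forall>u\<in>sphere 0 1.
           partial_t G t u / \<psi> s \<le> l * partial_t G (l * t) u / \<psi> (l * s) \<longrightarrow> l \<ge> 1)"
    show ?thesis
    proof (rule that[of "-1"])
      show "1 \<le> l" if "l > 0" "s > 0" "t > 0" "norm u = 1"
        "l * (-1 * partial_t G (l * t) u) / \<psi> (l * s) \<le> -1 * partial_t G t u / \<psi> s" for l s t u
        using conjunct2[OF b, rule_format, of l s t u] that by simp
    qed (use b in auto)
  qed
  define g where "g t u = sg * partial_t G t u" for t u
  have dilation: "(l * t) * g (l * t) u / \<psi> (l * s) < t * g t u / \<psi> s"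
    if "l > 1" "t > 0" "s > 0" "norm u = 1" for l t s u
  proof (rule ccontr)
    assume "\<not> (l * t) * g (l * t) u / \<psi> (l * s) < t * g t u / \<psi> s"
    then have "t * (g t u / \<psi> s) \<le> t * (l * (g (l * t) u / \<psi> (l * s)))" by (simp add: mult_ac)
    then have "g t u / \<psi> s \<le> l * (g (l * t) u / \<psi> (l * s))" using that(2) by (rule mult_left_le_imp_le)
    then have "(1 / l) * (g t u / \<psi> s) \<le> (1 / l) * (l * (g (l * t) u / \<psi> (l * s)))"
      using that(1) by (intro mult_left_mono) auto
    then have "(1 / l) * (g t u / \<psi> s) \<le> g (l * t) u / \<psi> (l * s)" using that(1) by simp
    \<comment> \<open>The hypothesis is applied to the factor 1 / l at the dilated arguments.\<close>
    then have "1 / l \<ge> 1"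
      using cond'[of "1 / l" "l * s" "l * t" u] that by (simp add: g_def)
    then show False using that by simp
  qed
  have partial: "partial_t G t u = sg * g t u" for t u using sg by (auto simp: g_def)
  have le: "support_fun L' v \<le> support_fun L v"
    if "convex_body_o L" "convex_body_o L'" "(polytope L \<and> polytope L') \<or> (C2_support L \<and> C2_support L')"
      "dual_curvature_defined G L" "dual_curvature_defined G L'"
      "\<And>E. E \<in> sets borel \<Longrightarrow> E \<subseteq> sphere 0 1 \<Longrightarrow> dual_curvature_measure G \<psi> L E = dual_curvature_measure G \<psi> L' E"
      "norm v = 1" for L L' v
    by (rule support_fun_le_if_same_curvature_measure[OF G_cont _ psi_cont _ partial sg _ dilation that])
       (use psi_pos G_diff pos in \<open>auto simp: g_def\<close>)
  show "K = K'"
  proof (rule equalityI)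
    show "K' \<subseteq> K"
      by (rule convex_body_subset_if_support_le[OF K K' le[OF K K' polytopes_or_C2 K_defined K'_defined]]) (use eq in auto)
    show "K \<subseteq> K'"
      by (rule convex_body_subset_if_support_le[OF K' K le[OF K' K _ K'_defined K_defined]]) (use eq polytopes_or_C2 in auto)
  qed
qed

end
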